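(* Let $v\in \mathcal{C}^2(\mathbb{H})$ and let $q\in\mathbb{H}$ be such that $\nabla_{\mathbb{H}}v(q)\neq0$. Given $1<p<\infty$, let $s_p,a_p>0$ satisfy $$\frac{3\pi}{2s_p^2}+a_p^2=p-1.$$ For $r>0$ and $q'\in B_r(q)$ set $$f_r(q')=\mathcal{A}_3\Big(v,\,s_pr;\;1+(a_p-1)\frac{|(q'-q)_{hor}|^2}{r^2},\;\frac{(q'-q)_{hor}}{|(q'-q)_{hor}|}\Big)(q').$$ Then, as $r\to0+$: $$\frac12\Big(\inf_{q'\in B_r(q)}f_r(q')+\sup_{q'\in B_r(q)}f_r(q')\Big)=v(q)+\frac{s_p^2\,r^2}{3\pi}\cdot\frac{\Delta_{\mathbb{H},p}v(q)}{|\nabla_{\mathbb{H}}v(q)|^{p-2}}+o(r^2).$$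
   Context: $\mathbb{H}=(\mathbb{R}^3,* )$ is the first Heisenberg group with $(x,y,z)*(x',y',z')=(x+x',y+y',z+z'+\frac12(xy'-yx'))$; for $q=(x,y,z)$ write $q_{hor}=(x,y)$; $q'-q$ is the Euclidean difference and $|\cdot|$ the Euclidean norm. The Korányi gauge is $|(x,y,z)|_K=((x^2+y^2)^2+16z^2)^{1/4}$, the metric is $d(q,q')=|q^{-1}*q'|_K$, $B_r(q)=\{q'\in\mathbb{H}: d(q,q')<r\}$, and the dilations are $\rho_\lambda(x,y,z)=(\lambda x,\lambda y,\lambda^2z)$. With $X=\partial_x-\frac y2\partial_z$, $Y=\partial_y+\frac x2\partial_z$, set $\nabla_{\mathbb{H}}v=(Xv,Yv)$ and $\Delta_{\mathbb{H},p}v=X\big(|\nabla_{\mathbb{H}}v|^{p-2}Xv\big)+Y\big(|\nabla_{\mathbb{H}}v|^{p-2}Yv\big)$. For $r>0$, an aspect ratio $\alpha>0$ and a vector $\nu\in\mathbb{R}^3$ with Euclidean norm $1$, define the Korányi ellipsoid $E(q,r;\alpha,\nu)=q*\rho_r\{p+(\alpha-1)\langle p,\nu\rangle\nu:\ p\in B_1(0)\}$, where $\langle\cdot,\cdot\rangle$ is the Euclidean scalar product in $\mathbb{R}^3$, and the average $\mathcal{A}_3(v,r;\alpha,\nu)(q)=\frac{1}{|E(q,r;\alpha,\nu)|}\int_{E(q,r;\alpha,\nu)}v(p)\,dp$. A unit vector $\nu_{hor}\in\mathbb{R}^2$ used as orientation is identified with $(\nu_{hor},0)\in\mathbb{R}^3$.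 When $(q'-q)_{hor}=0$ the aspect ratio in the definition of $f_r(q')$ equals $1$, the ellipsoid is $B_{s_pr}(q')$ irrespective of the orientation, and $f_r(q')$ is the mean value of $v$ on $B_{s_pr}(q')$. *)

theory Defs
  imports "HOL-Analysis.Analysis" "HOL-Library.Landau_Symbols"
begin

definition heis_mult :: "real^3 \<Rightarrow> real^3 \<Rightarrow> real^3"  (infixl \<open>\<odot>\<close> 70)
  where "q \<odot> q' = vector [q$1 + q'$1, q$2 + q'$2, q$3 + q'$3 + (q$1 * q'$2 - q$2 * q'$1) / 2]"

text \<open>The group inverse of \<open>q\<close> is \<open>- q\<close>, since \<open>q \<odot> (- q) = (- q) \<odot> q = 0\<close>.\<close>

definition heis_inv :: "real^3 \<Rightarrow> real^3"
  where "heis_inv q = - q"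

definition hor :: "real^3 \<Rightarrow> real^2"
  where "hor q = vector [q$1, q$2]"

definition of_hor :: "real^2 \<Rightarrow> real^3"
  where "of_hor u = vector [u$1, u$2, 0]"

definition koranyi_gauge :: "real^3 \<Rightarrow> real"
  where "koranyi_gauge q = root 4 (((q$1)\<^sup>2 + (q$2)\<^sup>2)\<^sup>2 + 16 * (q$3)\<^sup>2)"

definition koranyi_dist :: "real^3 \<Rightarrow> real^3 \<Rightarrow> real"
  where "koranyi_dist q q' = koranyi_gauge (heis_inv q \<odot> q')"

definition koranyi_ball :: "real^3 \<Rightarrow> real \<Rightarrow> (real^3) set"
  where "koranyi_ball q r = {q'. koranyi_dist q q' < r}"

definition heis_dilation :: "real \<Rightarrow> real^3 \<Rightarrow> real^3"
  where "heis_dilation l q = vector [l * q$1, l * q$2, l\<^sup>2 * q$3]"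

definition partial_deriv :: "3 \<Rightarrow> (real^3 \<Rightarrow> real) \<Rightarrow> real^3 \<Rightarrow> real"
  where "partial_deriv i v q = deriv (\<lambda>t. v (q + t *\<^sub>R axis i 1)) 0"

definition heis_X :: "(real^3 \<Rightarrow> real) \<Rightarrow> real^3 \<Rightarrow> real"
  where "heis_X v q = partial_deriv 1 v q - q$2 / 2 * partial_deriv 3 v q"

definition heis_Y :: "(real^3 \<Rightarrow> real) \<Rightarrow> real^3 \<Rightarrow> real"
  where "heis_Y v q = partial_deriv 2 v q + q$1 / 2 * partial_deriv 3 v q"

definition heis_grad :: "(real^3 \<Rightarrow> real) \<Rightarrow> real^3 \<Rightarrow> real^2"
  where "heis_grad v q = vector [heis_X v q, heis_Y v q]"

definition heis_p_laplacian :: "real \<Rightarrow> (real^3 \<Rightarrow> real) \<Rightarrow> real^3 \<Rightarrow> real"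
  where "heis_p_laplacian p v q =
    heis_X (\<lambda>w. norm (heis_grad v w) powr (p - 2) * heis_X v w) q +
    heis_Y (\<lambda>w. norm (heis_grad v w) powr (p - 2) * heis_Y v w) q"

text \<open>\<open>C\<^sup>2\<close> in the ordinary sense on the manifold \<open>\<real>\<^sup>3\<close>: \<open>g\<close> is the Euclidean gradient,
  \<open>H\<close> the Hessian matrix.\<close>

definition C2 :: "(real^3 \<Rightarrow> real) \<Rightarrow> bool"
  where "C2 v \<longleftrightarrow> (\<exists>(g :: real^3 \<Rightarrow> real^3) (H :: real^3 \<Rightarrow> real^3^3).
    (\<forall>w. (v has_derivative (\<lambda>h. g w \<bullet> h)) (at w)) \<and>
    (\<forall>w. (g has_derivative (\<lambda>h. H w *v h)) (at w)) \<and>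
    continuous_on UNIV H)"

text \<open>The orientation \<open>n\<close> is meant to be a unit vector; for \<open>\<alpha> = 1\<close> it is irrelevant and the
  ellipsoid is the ball \<open>koranyi_ball q r\<close> (for \<open>r > 0\<close>).\<close>

definition koranyi_ellipsoid :: "real^3 \<Rightarrow> real \<Rightarrow> real \<Rightarrow> real^3 \<Rightarrow> (real^3) set"
  where "koranyi_ellipsoid q r \<alpha> n =
    (\<lambda>w. q \<odot> heis_dilation r (w + ((\<alpha> - 1) * (w \<bullet> n)) *\<^sub>R n)) ` koranyi_ball 0 1"

definition ellipsoid_average ::
    "(real^3 \<Rightarrow> real) \<Rightarrow> real \<Rightarrow> real \<Rightarrow> real^3 \<Rightarrow> real^3 \<Rightarrow> real"
  where "ellipsoid_average v r \<alpha> n q =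
    1 / measure lebesgue (koranyi_ellipsoid q r \<alpha> n) *
    (LINT w:koranyi_ellipsoid q r \<alpha> n|lebesgue. v w)"

end

theory Submission
  imports Defs
begin

text \<open>
  Put \<open>q' = q \<odot> heis_dilation r w\<close> with \<open>w\<close> in the unit ball. The average defining \<open>f r q'\<close> pulls
  back to an average over \<open>u\<close> in the unit ball of \<open>v\<close> at \<open>q \<odot> heis_dilation r W\<close>, where
  \<open>W = w \<odot> heis_dilation s (L u)\<close> stays bounded and \<open>L\<close> is the linear stretching. One second order
  Taylor expansion at \<open>q\<close> and the second moments of the unit ball therefore give, uniformly in \<open>w\<close>,
  \<open>f r q' = v q + r * (\<nabla>v(q) \<bullet> hor w) + r\<^sup>2 * \<Phi> w + o(r\<^sup>2)\<close> with a polynomial \<open>\<Phi>\<close>. As \<open>r \<rightarrow> 0\<close> the linear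
  term forces the extrema to the horizontal unit vectors \<open>\<plusminus>\<nu>\<close> along the gradient, where \<open>\<Phi>\<close> takes
  the same value; in the mean of infimum and supremum the linear terms cancel, and the relation
  between \<open>s\<close>, \<open>a\<close> and \<open>p\<close> turns \<open>\<Phi>(\<nu>)\<close> into the normalised \<open>p\<close>-Laplacian.
\<close>

section \<open>Lebesgue measure on three-space by slices\<close>

lemma Basis_real_3: "(Basis :: (real^3) set) = {axis 1 1, axis 2 1, axis 3 1}"
  by (auto simp: Basis_vec_def UNIV_3)

lemma vec3_eq_iff: "(x::real^3) = y \<longleftrightarrow> x$1 = y$1 \<and> x$2 = y$2 \<and> x$3 = y$3"
  by (simp add: vec_eq_iff forall_3)

lemma prod_Basis_real_3: "(\<Prod>b\<in>Basis. f (b :: real^3)) = f (axis 1 1) * f (axis 2 1) * f (axis 3 1)"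
  for f :: "real^3 \<Rightarrow> 'a::comm_monoid_mult"
  by (simp add: Basis_real_3 axis_eq_axis mult.assoc)

lemma mem_box_real_3: "x \<in> box l u \<longleftrightarrow>
    l$1 < x$1 \<and> x$1 < u$1 \<and> l$2 < x$2 \<and> x$2 < u$2 \<and> l$3 < x$3 \<and> x$3 < u$3"
  for x :: "real^3"
  by (auto simp: mem_box_cart forall_3)

lemma mem_box_complex: "z \<in> box (Complex a b) (Complex c d) \<longleftrightarrow> a < Re z \<and> Re z < c \<and> b < Im z \<and> Im z < d"
  by (auto simp: box_def Basis_complex_def)

lemma emeasure_box_complex: "a \<le> c \<Longrightarrow> b \<le> d \<Longrightarrow>
    emeasure lborel (box (Complex a b) (Complex c d)) = ennreal ((c - a) * (d - b))"
  by (subst emeasure_lborel_box) (auto simp: Basis_complex_def)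

lemma borel_measurable_vector_3:
  "(\<lambda>(z, t). vector [Re z, Im z, t] :: real^3) \<in> borel_measurable (lborel \<Otimes>\<^sub>M lborel)"
proof -
  have "continuous_on UNIV (\<lambda>x. vector [Re (fst x), Im (fst x), snd x] :: real^3)"
    by (subst continuous_on_componentwise)
      (auto simp: Basis_real_3 inner_axis intro!: continuous_intros)
  then show ?thesis
    unfolding lborel_prod case_prod_unfold by (simp add: borel_measurable_continuous_onI)
qed

text \<open>Lebesgue measure is determined by its values on boxes, and the preimage of a box is a
  box in the complex plane times an interval. Modelling the horizontal plane by
  \<open>complex\<close> turns the slices of the Koranyi ball at constant height into discs.\<close>

lemma lborel_real_3_eq_distr:
  "(lborel :: (real^3) measure) =
    distr (lborel \<Otimes>\<^sub>M lborel) borel (\<lambda>(z, t). vector [Re z, Im z, t])"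
proof (rule lborel_eqI)
  let ?\<Psi> = "\<lambda>(z, t). vector [Re z, Im z, t] :: real^3"
  note [measurable] = borel_measurable_vector_3
  fix l u :: "real^3"
  assume lu: "\<And>b. b \<in> Basis \<Longrightarrow> l \<bullet> b \<le> u \<bullet> b"
  have le: "l$1 \<le> u$1" "l$2 \<le> u$2" "l$3 \<le> u$3"
    using lu[of "axis 1 1"] lu[of "axis 2 1"] lu[of "axis 3 1"]
    by (simp_all add: inner_axis axis_in_Basis_iff)
  have eq: "?\<Psi> -` box l u \<inter> space (lborel \<Otimes>\<^sub>M lborel)
      = box (Complex (l$1) (l$2)) (Complex (u$1) (u$2)) \<times> box (l$3) (u$3)"
    by (auto simp: mem_box_real_3 mem_box_complex space_pair_measure box_real)
  have "emeasure (distr (lborel \<Otimes>\<^sub>M lborel) borel ?\<Psi>) (box l u)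
      = emeasure (lborel \<Otimes>\<^sub>M lborel)
          (box (Complex (l$1) (l$2)) (Complex (u$1) (u$2)) \<times> box (l$3) (u$3))"
    by (subst emeasure_distr) (auto simp only: eq borel_measurable_vector_3 borel_open open_box)
  also have "\<dots> = emeasure lborel (box (Complex (l$1) (l$2)) (Complex (u$1) (u$2)))
      * emeasure lborel (box (l$3) (u$3))"
    by (rule lborel.emeasure_pair_measure_Times) auto
  also have "\<dots> = ennreal ((u$1 - l$1) * (u$2 - l$2)) * ennreal (u$3 - l$3)"
    using le by (simp add: emeasure_box_complex box_real)
  also have "\<dots> = ennreal (\<Prod>b\<in>Basis. (u - l) \<bullet> b)"
    using le by (simp add: prod_Basis_real_3 inner_axis ennreal_mult'')
  finally show "emeasure (distr (lborel \<Otimes>\<^sub>M lborel) borel ?\<Psi>) (box l u)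
      = (\<Prod>b\<in>Basis. (u - l) \<bullet> b)" by simp
qed simp

lemma nn_integral_real_3:
  assumes [measurable]: "f \<in> borel_measurable borel"
  shows "(\<integral>\<^sup>+w. f w \<partial>(lborel :: (real^3) measure))
    = (\<integral>\<^sup>+t. \<integral>\<^sup>+z. f (vector [Re z, Im z, t]) \<partial>lborel \<partial>lborel)"
proof -
  let ?\<Psi> = "\<lambda>(z, t). vector [Re z, Im z, t] :: real^3"
  note [measurable] = borel_measurable_vector_3
  have "(\<integral>\<^sup>+w. f w \<partial>(lborel :: (real^3) measure)) = (\<integral>\<^sup>+x. f (?\<Psi> x) \<partial>(lborel \<Otimes>\<^sub>M lborel))"
    by (subst lborel_real_3_eq_distr) (simp add: nn_integral_distr)
  also have "\<dots> = (\<integral>\<^sup>+t. \<integral>\<^sup>+z. f (?\<Psi> (z, t)) \<partial>lborel \<partial>lborel)"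
    by (rule lborel_pair.nn_integral_snd[symmetric]) measurable
  finally show ?thesis by simp
qed

section \<open>Area and second moment of a planar disc\<close>

lemma emeasure_complex_ball: "0 \<le> r \<Longrightarrow> emeasure lborel (ball (0::complex) r) = ennreal (pi * r\<^sup>2)"
  and emeasure_complex_cball: "0 \<le> r \<Longrightarrow> emeasure lborel (cball (0::complex) r) = ennreal (pi * r\<^sup>2)"
  by (simp_all add: emeasure_ball emeasure_cball unit_ball_vol_2)

text \<open>Layer cake formula in place of polar coordinates: the squared modulus is the length of
  the interval of all s with 0 <= s < |z|^2. After exchanging the integrals, the slice at s is the
  annulus sqrt s < |z| < r of area pi (r^2 - s), and s runs over [0, r^2].\<close>

lemma nn_integral_norm_squared_complex_ball:
  assumes r: "0 \<le> r"
  shows "(\<integral>\<^sup>+z. ennreal ((cmod z)\<^sup>2) * indicator (ball 0 r) z \<partial>lborel) = ennreal (pi / 2 * r^4)"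
proof -
  have "(\<integral>\<^sup>+z. ennreal ((cmod z)\<^sup>2) * indicator (ball 0 r) z \<partial>lborel)
      = (\<integral>\<^sup>+z. \<integral>\<^sup>+s. indicator {(z, s). 0 \<le> s \<and> s < (cmod z)\<^sup>2 \<and> cmod z < r} (z, s) \<partial>lborel \<partial>lborel)"
  proof (rule nn_integral_cong)
    fix z :: complex
    have *: "indicator {(z, s). 0 \<le> s \<and> s < (cmod z)\<^sup>2 \<and> cmod z < r} (z, s)
        = (indicator (if cmod z < r then {0..<(cmod z)\<^sup>2} else {}) s :: ennreal)" for s
      by (auto simp: indicator_def)
    show "ennreal ((cmod z)\<^sup>2) * indicator (ball 0 r) z
        = (\<integral>\<^sup>+s. indicator {(z, s). 0 \<le> s \<and> s < (cmod z)\<^sup>2 \<and> cmod z < r} (z, s) \<partial>lborel)"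
      unfolding * by simp
  qed
  also have "\<dots> = (\<integral>\<^sup>+s. \<integral>\<^sup>+z. indicator {(z, s). 0 \<le> s \<and> s < (cmod z)\<^sup>2 \<and> cmod z < r} (z, s) \<partial>lborel \<partial>lborel)"
    by (rule lborel_pair.Fubini'[symmetric]) measurable
  also have "\<dots> = (\<integral>\<^sup>+s. ennreal (pi * (r\<^sup>2 - s)) * indicator {0..r\<^sup>2} s \<partial>lborel)"
  proof (rule nn_integral_cong)
    fix s :: real
    show "(\<integral>\<^sup>+z. indicator {(z, s). 0 \<le> s \<and> s < (cmod z)\<^sup>2 \<and> cmod z < r} (z, s) \<partial>lborel)
        = ennreal (pi * (r\<^sup>2 - s)) * indicator {0..r\<^sup>2} s"
    proof (cases "s \<in> {0..r\<^sup>2}")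
      case True
      then have s: "0 \<le> s" "s \<le> r\<^sup>2" by auto
      have sr: "sqrt s \<le> r" using s r by (simp add: real_le_lsqrt)
      have "s < (cmod z)\<^sup>2 \<longleftrightarrow> sqrt s < cmod z" for z
        using real_sqrt_less_iff[of s "(cmod z)\<^sup>2"] by simp
      then have "(\<integral>\<^sup>+z. indicator {(z, s). 0 \<le> s \<and> s < (cmod z)\<^sup>2 \<and> cmod z < r} (z, s) \<partial>lborel)
          = (\<integral>\<^sup>+z. indicator (ball 0 r - cball (0::complex) (sqrt s)) z \<partial>lborel)"
        using s by (intro nn_integral_cong) (auto simp: indicator_def)
      also have "\<dots> = emeasure lborel (ball 0 r - cball (0::complex) (sqrt s))"
        by simp
      also have "\<dots> = ennreal (pi * (r\<^sup>2 - s))"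
      \<comment> \<open>At s = r^2 the annulus is empty and must be split off: the closed disc lies
        inside the open one only when its radius is strictly smaller.\<close>
      proof (cases "sqrt s = r")
        case True
        then have *: "ball 0 r - cball (0::complex) (sqrt s) = {}" by auto
        show ?thesis unfolding * using True s by auto
      next
        case False
        then have "cball (0::complex) (sqrt s) \<subseteq> ball 0 r" using sr by auto
        then show ?thesis using s r
          using emeasure_complex_cball[of "sqrt s"] emeasure_complex_ball[of r]
          by (subst emeasure_Diff) (auto simp: ennreal_minus right_diff_distrib)
      qed
      finally show ?thesis using True by simp
    next
      case False
      have "\<not> (0 \<le> s \<and> s < (cmod z)\<^sup>2 \<and> cmod z < r)" for z
        using False power_mono[of "cmod z" r 2] norm_ge_zero[of z] by (meson atLeastAtMost_iff less_eq_real_def less_le_trans not_less)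
      then have *: "{(z, s). 0 \<le> s \<and> s < (cmod z)\<^sup>2 \<and> cmod z < r} \<inter> UNIV \<times> {s} = {}"
        by auto
      have **: "indicator {(z, s). 0 \<le> s \<and> s < (cmod z)\<^sup>2 \<and> cmod z < r} (z, s) = (0::ennreal)" for z
        using * by (auto simp: indicator_def)
      show ?thesis unfolding ** using False by simp
    qed
  qed
  also have "\<dots> = ennreal (pi / 2 * r^4)"
  proof (rule nn_integral_has_integral_lebesgue')
    have "((\<lambda>s. pi * (r\<^sup>2 - s)) has_integral (pi * (r\<^sup>2 * r\<^sup>2 - (r\<^sup>2)\<^sup>2 / 2)) - pi * (r\<^sup>2 * 0 - 0\<^sup>2 / 2)) {0..r\<^sup>2}"
      by (rule fundamental_theorem_of_calculus)
        (auto simp: has_real_derivative_iff_has_vector_derivative[symmetric]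
          intro!: derivative_eq_intros)
    then show "((\<lambda>s. pi * (r\<^sup>2 - s)) has_integral pi / 2 * r^4) {0..r\<^sup>2}"
      by (simp add: power2_eq_square power4_eq_xxxx algebra_simps)
  qed auto
  finally show ?thesis .
qed

section \<open>The Koranyi unit ball\<close>

lemma koranyi_unit_ball_eq:
  "koranyi_ball 0 1 = {w. ((w$1)\<^sup>2 + (w$2)\<^sup>2)\<^sup>2 + 16 * (w$3)\<^sup>2 < 1}"
  by (simp add: koranyi_ball_def koranyi_dist_def koranyi_gauge_def heis_inv_def heis_mult_def)

lemma open_koranyi_unit_ball: "open (koranyi_ball 0 1)"
  unfolding koranyi_unit_ball_eq by (intro open_Collect_less continuous_intros)

lemma koranyi_quartic_less_1D:
  fixes a b :: real
  assumes "((a)\<^sup>2 + (b)\<^sup>2)\<^sup>2 + 16 * c\<^sup>2 < 1"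
  shows "a\<^sup>2 + b\<^sup>2 < 1" "c\<^sup>2 < 1"
proof -
  have "((a)\<^sup>2 + (b)\<^sup>2)\<^sup>2 < 1\<^sup>2" using assms by (smt (verit) one_power2 zero_le_power2)
  then show "a\<^sup>2 + b\<^sup>2 < 1" by (rule power_less_imp_less_base) simp
  show "c\<^sup>2 < 1" using assms by (smt (verit) zero_le_power2)
qed

lemma koranyi_unit_ball_bounds:
  assumes "w \<in> koranyi_ball 0 1"
  shows "(w$1)\<^sup>2 + (w$2)\<^sup>2 < 1" "\<bar>w$1\<bar> < 1" "\<bar>w$2\<bar> < 1" "\<bar>w$3\<bar> < 1"
proof -
  from assms have 1: "(w$1)\<^sup>2 + (w$2)\<^sup>2 < 1" and 2: "(w$3)\<^sup>2 < 1"
    unfolding koranyi_unit_ball_eq mem_Collect_eq by (fact koranyi_quartic_less_1D)+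
  show "(w$1)\<^sup>2 + (w$2)\<^sup>2 < 1" by (rule 1)
  have "(w$1)\<^sup>2 < 1" "(w$2)\<^sup>2 < 1"
    using 1 by (smt (verit) zero_le_power2)+
  with 2 show "\<bar>w$1\<bar> < 1" "\<bar>w$2\<bar> < 1" "\<bar>w$3\<bar> < 1"
    by (simp_all add: abs_square_less_1)
qed

lemma bounded_koranyi_unit_ball: "bounded (koranyi_ball 0 1)"
proof (rule boundedI)
  fix w :: "real^3" assume "w \<in> koranyi_ball 0 1"
  then have "(\<Sum>i\<in>UNIV. \<bar>w $ i\<bar>) \<le> 3"
    using koranyi_unit_ball_bounds[of w] by (simp add: sum_3)
  then show "norm w \<le> 3"
    using norm_le_l1_cart[of w] by linarith
qed

lemma lmeasurable_koranyi_unit_ball: "koranyi_ball 0 1 \<in> lmeasurable"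
  by (simp add: bounded_koranyi_unit_ball lmeasurable_open open_koranyi_unit_ball)

lemma power2_less_iff_less_sqrt: "0 \<le> x \<Longrightarrow> x\<^sup>2 < y \<longleftrightarrow> x < sqrt y"
  using real_sqrt_less_iff[of "x\<^sup>2" y] by simp

text \<open>Valid for every t because \<open>sqrt\<close> is extended as an odd function: when 16
  t^2 > 1 the nested root is negative, and the ball of negative radius is empty like the
  slice.\<close>

lemma koranyi_unit_ball_slice:
  "vector [Re z, Im z, t] \<in> koranyi_ball 0 1 \<longleftrightarrow> z \<in> ball 0 (sqrt (sqrt (1 - 16 * t\<^sup>2)))"
proof -
  have "vector [Re z, Im z, t] \<in> koranyi_ball 0 1 \<longleftrightarrow> ((cmod z)\<^sup>2)\<^sup>2 < 1 - 16 * t\<^sup>2"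
    by (auto simp: koranyi_unit_ball_eq cmod_power2)
  then show ?thesis
    by (simp only: power2_less_iff_less_sqrt zero_le_power2 norm_ge_zero mem_ball_0)
qed

lemma slice_radius:
  "t \<in> {-1/4..1/4} \<Longrightarrow> 0 \<le> 1 - 16 * t\<^sup>2" "t \<notin> {-1/4..1/4} \<Longrightarrow> 1 - 16 * t\<^sup>2 < 0"
  for t :: real
  using abs_square_le_1[of "4 * t"] by (auto simp: power_mult_distrib)

lemma emeasure_koranyi_unit_ball: "emeasure lborel (koranyi_ball 0 1) = ennreal (pi\<^sup>2 / 8)"
proof -
  have [measurable]: "koranyi_ball 0 1 \<in> sets borel"
    by (simp add: open_koranyi_unit_ball)
  have "emeasure lborel (koranyi_ball 0 1) = (\<integral>\<^sup>+w. indicator (koranyi_ball 0 1) w \<partial>lborel)"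
    by simp
  also have "\<dots> = (\<integral>\<^sup>+t. \<integral>\<^sup>+z. indicator (koranyi_ball 0 1) (vector [Re z, Im z, t] :: real^3) \<partial>lborel \<partial>lborel)"
    by (rule nn_integral_real_3) simp
  also have "\<dots> = (\<integral>\<^sup>+t. ennreal (pi * sqrt (1 - 16 * t\<^sup>2)) * indicator {-1/4..1/4} t \<partial>lborel)"
  proof (rule nn_integral_cong)
    fix t :: real
    have *: "indicator (koranyi_ball 0 1) (vector [Re z, Im z, t] :: real^3)
        = (indicator (ball 0 (sqrt (sqrt (1 - 16 * t\<^sup>2)))) z :: ennreal)" for z
      by (simp only: indicator_def koranyi_unit_ball_slice)
    have "(\<integral>\<^sup>+z. indicator (koranyi_ball 0 1) (vector [Re z, Im z, t] :: real^3) \<partial>lborel)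
        = emeasure lborel (ball (0::complex) (sqrt (sqrt (1 - 16 * t\<^sup>2))))"
      unfolding * by simp
    also have "\<dots> = ennreal (pi * sqrt (1 - 16 * t\<^sup>2)) * indicator {-1/4..1/4} t"
    proof (cases "t \<in> {-1/4..1/4}")
      case True
      then show ?thesis
        using slice_radius(1)[OF True] by (simp add: emeasure_complex_ball)
    next
      case False
      then have *: "ball (0::complex) (sqrt (sqrt (1 - 16 * t\<^sup>2))) = {}"
        using slice_radius(2)[OF False] by simp
      show ?thesis
        unfolding * using False by simp
    qed
    finally show "(\<integral>\<^sup>+z. indicator (koranyi_ball 0 1) (vector [Re z, Im z, t] :: real^3) \<partial>lborel)
        = ennreal (pi * sqrt (1 - 16 * t\<^sup>2)) * indicator {-1/4..1/4} t" .
  qed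
  also have "\<dots> = ennreal (pi\<^sup>2 / 8)"
  proof (rule nn_integral_has_integral_lebesgue')
    \<comment> \<open>Antiderivative obtained from the substitution 4 t = sin \<theta>. Its root and
      arcsine are not differentiable at the end points, hence the interior version of the
      fundamental theorem.\<close>
    let ?F = "\<lambda>t. pi * (t * sqrt (1 - 16 * t\<^sup>2) / 2 + arcsin (4 * t) / 8)"
    have "((\<lambda>t. pi * sqrt (1 - 16 * t\<^sup>2)) has_integral ?F (1/4) - ?F (-1/4)) {-1/4..1/4}"
    proof (rule fundamental_theorem_of_calculus_interior)
      show "continuous_on {-1/4..1/4} ?F"
        by (intro continuous_intros) auto
      fix t :: real assume t: "t \<in> {-1/4<..<1/4}"
      have pos: "0 < 1 - 16 * t\<^sup>2"
        using t abs_square_less_1[of "4 * t"] by (auto simp: power_mult_distrib)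
      have sq: "sqrt (1 - 16 * t\<^sup>2) * sqrt (1 - 16 * t\<^sup>2) = 1 - 16 * t\<^sup>2"
        using pos by simp
      have "(?F has_real_derivative
          pi * ((sqrt (1 - 16 * t\<^sup>2) + t * ((0 - 16 * (2 * t)) * (inverse (sqrt (1 - 16 * t\<^sup>2)) / 2))) / 2
            + 4 * inverse (sqrt (1 - (4 * t)\<^sup>2)) / 8)) (at t)"
        using t pos by (auto intro!: derivative_eq_intros simp: power_mult_distrib field_simps)
      also have "pi * ((sqrt (1 - 16 * t\<^sup>2) + t * ((0 - 16 * (2 * t)) * (inverse (sqrt (1 - 16 * t\<^sup>2)) / 2))) / 2
            + 4 * inverse (sqrt (1 - (4 * t)\<^sup>2)) / 8) = pi * sqrt (1 - 16 * t\<^sup>2)"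
        using pos sq by (simp add: power_mult_distrib field_simps power2_eq_square)
      finally show "(?F has_vector_derivative pi * sqrt (1 - 16 * t\<^sup>2)) (at t)"
        by (simp add: has_real_derivative_iff_has_vector_derivative)
    qed simp
    then show "((\<lambda>t. pi * sqrt (1 - 16 * t\<^sup>2)) has_integral pi\<^sup>2 / 8) {-1/4..1/4}"
      by (simp add: arcsin_minus power2_eq_square power_divide)
    show "0 \<le> pi * sqrt (1 - 16 * t\<^sup>2)" if "t \<in> {-1/4..1/4}" for t
      using slice_radius(1)[OF that] by simp
  qed
  finally show ?thesis .
qed

text \<open>The disc moment involves the fourth power of the slice radius, which is 1 - 16 t^2, so
  the remaining integral in t is that of a polynomial.\<close>

lemma nn_integral_hor_squared_koranyi_unit_ball:
  "(\<integral>\<^sup>+w. ennreal ((w$1)\<^sup>2 + (w$2)\<^sup>2) * indicator (koranyi_ball 0 1) w \<partial>lborel) = ennreal (pi / 6)"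
proof -
  have [measurable]: "koranyi_ball 0 1 \<in> sets borel"
    by (simp add: open_koranyi_unit_ball)
  have [measurable]: "(\<lambda>w::real^3. w $ i) \<in> borel_measurable borel" for i
    by (intro borel_measurable_continuous_onI continuous_intros)
  have "(\<integral>\<^sup>+w. ennreal ((w$1)\<^sup>2 + (w$2)\<^sup>2) * indicator (koranyi_ball 0 1) w \<partial>lborel)
      = (\<integral>\<^sup>+t. \<integral>\<^sup>+z. ennreal (((vector [Re z, Im z, t] :: real^3)$1)\<^sup>2 + ((vector [Re z, Im z, t] :: real^3)$2)\<^sup>2)
          * indicator (koranyi_ball 0 1) (vector [Re z, Im z, t] :: real^3) \<partial>lborel \<partial>lborel)"
    by (rule nn_integral_real_3) measurable
  also have "\<dots> = (\<integral>\<^sup>+t. ennreal (pi / 2 * (1 - 16 * t\<^sup>2)) * indicator {-1/4..1/4} t \<partial>lborel)"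
  proof (rule nn_integral_cong)
    fix t :: real
    have *: "indicator (koranyi_ball 0 1) (vector [Re z, Im z, t] :: real^3)
        = (indicator (ball 0 (sqrt (sqrt (1 - 16 * t\<^sup>2)))) z :: ennreal)" for z
      by (simp only: indicator_def koranyi_unit_ball_slice)
    have eq: "ennreal (((vector [Re z, Im z, t] :: real^3)$1)\<^sup>2 + ((vector [Re z, Im z, t] :: real^3)$2)\<^sup>2)
          * indicator (koranyi_ball 0 1) (vector [Re z, Im z, t] :: real^3)
        = ennreal ((cmod z)\<^sup>2) * indicator (ball 0 (sqrt (sqrt (1 - 16 * t\<^sup>2)))) z" for z
      unfolding * by (simp add: cmod_power2)
    show "(\<integral>\<^sup>+z. ennreal (((vector [Re z, Im z, t] :: real^3)$1)\<^sup>2 + ((vector [Re z, Im z, t] :: real^3)$2)\<^sup>2)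
          * indicator (koranyi_ball 0 1) (vector [Re z, Im z, t] :: real^3) \<partial>lborel)
        = ennreal (pi / 2 * (1 - 16 * t\<^sup>2)) * indicator {-1/4..1/4} t"
    proof (cases "t \<in> {-1/4..1/4}")
      case True
      note nn = slice_radius(1)[OF True]
      have "sqrt (sqrt (1 - 16 * t\<^sup>2)) ^ 4 = ((sqrt (sqrt (1 - 16 * t\<^sup>2)))\<^sup>2)\<^sup>2"
        by simp
      also have "\<dots> = 1 - 16 * t\<^sup>2"
        using nn by (simp only: real_sqrt_pow2 real_sqrt_ge_zero)
      finally show ?thesis
        unfolding eq using True nn nn_integral_norm_squared_complex_ball[of "sqrt (sqrt (1 - 16 * t\<^sup>2))"]
        by simp
    next
      case False
      then have *: "ball (0::complex) (sqrt (sqrt (1 - 16 * t\<^sup>2))) = {}"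
        using slice_radius(2)[OF False] by simp
      show ?thesis
        unfolding eq unfolding * using False by simp
    qed
  qed
  also have "\<dots> = ennreal (pi / 6)"
  proof (rule nn_integral_has_integral_lebesgue')
    let ?F = "\<lambda>t. pi / 2 * (t - 16 * t^3 / 3)"
    have "((\<lambda>t. pi / 2 * (1 - 16 * t\<^sup>2)) has_integral ?F (1/4) - ?F (-1/4)) {-1/4..1/4}"
      by (rule fundamental_theorem_of_calculus)
        (auto simp: has_real_derivative_iff_has_vector_derivative[symmetric]
          intro!: derivative_eq_intros)
    then show "((\<lambda>t. pi / 2 * (1 - 16 * t\<^sup>2)) has_integral pi / 6) {-1/4..1/4}"
      by (simp add: power_divide)
    show "0 \<le> pi / 2 * (1 - 16 * t\<^sup>2)" if "t \<in> {-1/4..1/4}" for t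
      using slice_radius(1)[OF that] by simp
  qed
  finally show ?thesis .
qed

section \<open>Averages and moments\<close>

lemma absolutely_integrable_on_continuous_bounded:
  fixes f :: "'a::euclidean_space \<Rightarrow> 'b::euclidean_space"
  assumes f: "continuous_on UNIV f" and S: "bounded S" "S \<in> lmeasurable"
  shows "f absolutely_integrable_on S"
proof -
  obtain a where a: "S \<subseteq> cbox (-a) a"
    using bounded_subset_cbox_symmetric[OF S(1)] by blast
  have "f absolutely_integrable_on cbox (-a) a"
    using f by (intro absolutely_integrable_continuous) (auto intro: continuous_on_subset)
  then show ?thesis
    by (rule set_integrable_subset) (use S a in auto)
qed

lemma integral_affine_image:
  fixes f :: "real^'n::{finite,wellorder} \<Rightarrow> real" and A :: "real^'n::_ \<Rightarrow> real^'n::_"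
  assumes A: "linear A" "inj A" and S: "S \<in> sets lebesgue"
    and f: "f absolutely_integrable_on ((\<lambda>u. b + A u) ` S)"
  shows "integral ((\<lambda>u. b + A u) ` S) f = \<bar>det (matrix A)\<bar> * integral S (\<lambda>u. f (b + A u))"
proof -
  \<comment> \<open>The change of variables theorem takes functions with values in some
    \<open>real^'n\<close>, so f is regarded as a map into \<open>real^1\<close> and its single
    component is read off at the end.\<close>
  let ?g = "\<lambda>u. b + A u" and ?F = "\<lambda>u. vec (f u) :: real^1"
  have F: "?F absolutely_integrable_on (?g ` S)"
    using f by (simp add: absolutely_integrable_on_1_iff)
  have "integral (?g ` S) ?F = integral S (\<lambda>u. \<bar>det (matrix A)\<bar> *\<^sub>R ?F (?g u))"
  proof (rule integral_change_of_variables[OF S])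
    show "(?g has_derivative A) (at x within S)" for x
      using linear_imp_has_derivative[OF A(1), of "at x within S"] by (auto intro!: derivative_eq_intros)
    show "inj_on ?g S"
      using A(2) by (auto simp: inj_on_def)
  qed (use F in auto)
  then have "integral (?g ` S) ?F $ 1 = integral S (\<lambda>u. \<bar>det (matrix A)\<bar> *\<^sub>R ?F (?g u)) $ 1"
    by simp
  then show ?thesis
    by (simp add: integral_on_1_eq)
qed

definition average :: "'a::euclidean_space set \<Rightarrow> ('a \<Rightarrow> real) \<Rightarrow> real"
  where "average S f = 1 / measure lebesgue S * (LINT w:S|lebesgue. f w)"

text \<open>The Jacobian of an affine map is constant and appears both in the integral and in the
  measure of the image, so it cancels. Injectivity makes it nonzero.\<close>

lemma average_affine_image:
  fixes f :: "real^'n::{finite,wellorder} \<Rightarrow> real" and A :: "real^'n::_ \<Rightarrow> real^'n::_"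
  assumes A: "linear A" "inj A" and S: "bounded S" "S \<in> lmeasurable"
    and f: "continuous_on UNIV f"
  shows "average ((\<lambda>u. b + A u) ` S) f = average S (\<lambda>u. f (b + A u))"
proof -
  let ?g = "\<lambda>u. b + A u"
  have img: "?g ` S = (+) b ` (A ` S)" by auto
  have bdd: "bounded (?g ` S)"
    unfolding img using A S by (intro bounded_translation bounded_linear_image) (auto simp: linear_linear)
  have meas: "?g ` S \<in> lmeasurable"
    unfolding img using A S by (intro measurable_translation measurable_linear_image)
  have contA: "continuous_on UNIV A"
    using A(1) by (simp add: linear_continuous_on linear_linear)
  have contf: "continuous_on UNIV (\<lambda>u. f (?g u))"
    using continuous_on_compose2[OF f, of UNIV ?g] contA by (simp add: continuous_intros)
  have d: "\<bar>det (matrix A)\<bar> \<noteq> 0"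
    using A det_nz_iff_inj by auto
  note ai = absolutely_integrable_on_continuous_bounded
  have m: "measure lebesgue (?g ` S) = \<bar>det (matrix A)\<bar> * measure lebesgue S"
    using integral_affine_image[OF A, of S b "\<lambda>_. 1"] S meas bdd
    by (simp add: lmeasure_integral fmeasurableD ai)
  have "(LINT w:?g ` S|lebesgue. f w) = \<bar>det (matrix A)\<bar> * (LINT u:S|lebesgue. f (?g u))"
    using integral_affine_image[OF A fmeasurableD[OF S(2)] ai[OF f bdd meas]]
    by (simp add: set_lebesgue_integral_eq_integral(2) ai f bdd meas contf S)
  then show ?thesis
    using d by (simp add: average_def m)
qed

context
  fixes S :: "'a::euclidean_space set"
  assumes S: "bounded S" "S \<in> lmeasurable" "measure lebesgue S \<noteq> 0"
begin

lemma average_cmult: "average S (\<lambda>u. c * f u) = c * average S f"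
  by (simp add: average_def)

lemma average_const: "average S (\<lambda>_. c) = c"
proof -
  have "average S (\<lambda>_. 1) = 1"
    using S by (simp add: average_def lmeasure_integral absolutely_integrable_on_continuous_bounded
        set_lebesgue_integral_eq_integral(2))
  then show ?thesis
    using average_cmult[of c "\<lambda>_. 1"] by simp
qed

lemma average_add:
  "continuous_on UNIV f \<Longrightarrow> continuous_on UNIV g \<Longrightarrow>
    average S (\<lambda>u. f u + g u) = average S f + average S g"
  using S by (simp add: average_def set_integral_add absolutely_integrable_on_continuous_bounded distrib_left)

lemma average_minus: "average S (\<lambda>u. - f u) = - average S f"
  using average_cmult[of "-1" f] by simp

text \<open>Carries a uniform Taylor remainder over to averages: f <= g + e and g <= f + e on S are
  both averaged, and the constant e averages to itself because S has nonzero measure.\<close>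

lemma average_diff_le:
  assumes fg: "continuous_on UNIV f" "continuous_on UNIV g"
    and le: "\<And>u. u \<in> S \<Longrightarrow> \<bar>f u - g u\<bar> \<le> e"
  shows "\<bar>average S f - average S g\<bar> \<le> e"
proof -
  note ai = absolutely_integrable_on_continuous_bounded[OF _ S(1,2)]
  have le1: "average S h \<le> average S k"
    if "continuous_on UNIV h" "continuous_on UNIV k" "\<And>u. u \<in> S \<Longrightarrow> h u \<le> k u" for h k
    unfolding average_def using that
    by (intro mult_left_mono set_integral_mono ai) auto
  have "average S f \<le> average S (\<lambda>u. g u + e)"
    using fg le by (intro le1 continuous_intros) (auto simp: abs_le_iff algebra_simps)
  moreover have "average S g \<le> average S (\<lambda>u. f u + e)"
    using fg le by (intro le1 continuous_intros) (fastforce simp: abs_le_iff algebra_simps)+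
  ultimately show ?thesis
    using fg by (simp add: average_add average_const)
qed

end

section \<open>Moments of the Koranyi unit ball\<close>

lemma measure_koranyi_unit_ball: "measure lebesgue (koranyi_ball 0 1) = pi\<^sup>2 / 8"
  using emeasure_koranyi_unit_ball open_koranyi_unit_ball
  by (simp add: measure_def)

lemma measure_koranyi_unit_ball_nz: "measure lebesgue (koranyi_ball 0 1) \<noteq> 0"
  by (simp add: measure_koranyi_unit_ball)

lemmas koranyi_unit_ball_props =
  bounded_koranyi_unit_ball lmeasurable_koranyi_unit_ball measure_koranyi_unit_ball_nz

lemma average_hor_squared: "average (koranyi_ball 0 1) (\<lambda>w. (w$1)\<^sup>2 + (w$2)\<^sup>2) = 4 / (3 * pi)"
proof -
  have meas: "(\<lambda>w. indicator (koranyi_ball 0 1) w *\<^sub>R ((w$1)\<^sup>2 + (w$2)\<^sup>2)) \<in> borel_measurable lborel"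
    by (intro borel_measurable_scaleR borel_measurable_indicator)
      (auto simp: open_koranyi_unit_ball intro!: borel_measurable_continuous_onI continuous_intros)
  have "(LINT w:koranyi_ball 0 1|lebesgue. (w$1)\<^sup>2 + (w$2)\<^sup>2)
      = (\<integral>w. indicator (koranyi_ball 0 1) w *\<^sub>R ((w$1)\<^sup>2 + (w$2)\<^sup>2) \<partial>lborel)"
    unfolding set_lebesgue_integral_def by (rule integral_completion[OF meas])
  also have "\<dots> = enn2real (\<integral>\<^sup>+w. ennreal (indicator (koranyi_ball 0 1) w *\<^sub>R ((w$1)\<^sup>2 + (w$2)\<^sup>2)) \<partial>lborel)"
    by (rule integral_eq_nn_integral[OF meas]) auto
  also have "(\<integral>\<^sup>+w. ennreal (indicator (koranyi_ball 0 1) w *\<^sub>R ((w$1)\<^sup>2 + (w$2)\<^sup>2)) \<partial>lborel)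
      = (\<integral>\<^sup>+w. ennreal ((w$1)\<^sup>2 + (w$2)\<^sup>2) * indicator (koranyi_ball 0 1) w \<partial>lborel)"
    by (rule nn_integral_cong) (simp add: indicator_def)
  finally have *: "(LINT w:koranyi_ball 0 1|lebesgue. (w$1)\<^sup>2 + (w$2)\<^sup>2) = pi / 6"
    unfolding nn_integral_hor_squared_koranyi_unit_ball by simp
  show ?thesis
    unfolding average_def measure_koranyi_unit_ball * by (simp add: power2_eq_square)
qed

text \<open>An involution that maps the ball into itself maps it onto itself, so the affine image
  rule applies with zero translation.\<close>

lemma average_koranyi_ball_symmetry:
  assumes A: "linear A" and AA: "\<And>u. A (A u) = u"
    and inv: "\<And>u. u \<in> koranyi_ball 0 1 \<Longrightarrow> A u \<in> koranyi_ball 0 1"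
    and f: "continuous_on UNIV f"
  shows "average (koranyi_ball 0 1) (\<lambda>u. f (A u)) = average (koranyi_ball 0 1) f"
proof -
  have "inj A" using AA by (metis injI)
  moreover have "A ` koranyi_ball 0 1 = koranyi_ball 0 1"
    using inv AA by (metis imageI image_subset_iff subsetI subset_antisym)
  ultimately show ?thesis
    using average_affine_image[OF A _ bounded_koranyi_unit_ball lmeasurable_koranyi_unit_ball f, of 0]
    by simp
qed

lemma average_koranyi_ball_odd:
  assumes A: "linear A" "\<And>u. A (A u) = u"
    "\<And>u. u \<in> koranyi_ball 0 1 \<Longrightarrow> A u \<in> koranyi_ball 0 1"
    and f: "continuous_on UNIV f" and odd: "\<And>u. f (A u) = - f u"
  shows "average (koranyi_ball 0 1) f = 0"
  using average_koranyi_ball_symmetry[OF A f] average_minus[OF koranyi_unit_ball_props, of f]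
  by (simp add: odd)

text \<open>Reflecting one coordinate kills every moment that is odd in it. Exchanging the two
  horizontal coordinates makes the second moments equal, so each is half of the horizontal moment 4
  / (3 pi).\<close>

lemma average_koranyi_ball_moments:
  shows "average (koranyi_ball 0 1) (\<lambda>u. u$1) = 0"
    and "average (koranyi_ball 0 1) (\<lambda>u. u$2) = 0"
    and "average (koranyi_ball 0 1) (\<lambda>u. u$3) = 0"
    and "average (koranyi_ball 0 1) (\<lambda>u. u$1 * u$2) = 0"
    and "average (koranyi_ball 0 1) (\<lambda>u. (u$1)\<^sup>2) = 2 / (3 * pi)"
    and "average (koranyi_ball 0 1) (\<lambda>u. (u$2)\<^sup>2) = 2 / (3 * pi)"
proof -
  let ?R1 = "\<lambda>u::real^3. vector [- u$1, u$2, u$3] :: real^3"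
  let ?R2 = "\<lambda>u::real^3. vector [u$1, - u$2, u$3] :: real^3"
  let ?R3 = "\<lambda>u::real^3. vector [u$1, u$2, - u$3] :: real^3"
  let ?T = "\<lambda>u::real^3. vector [u$2, u$1, u$3] :: real^3"
  have lin: "linear ?R1" "linear ?R2" "linear ?R3" "linear ?T"
    by (auto intro!: linearI simp: vec3_eq_iff)
  have inv: "?R1 (?R1 u) = u" "?R2 (?R2 u) = u" "?R3 (?R3 u) = u" "?T (?T u) = u" for u
    by (simp_all add: vec3_eq_iff)
  have pres: "?R1 u \<in> koranyi_ball 0 1" "?R2 u \<in> koranyi_ball 0 1" "?R3 u \<in> koranyi_ball 0 1"
      "?T u \<in> koranyi_ball 0 1" if "u \<in> koranyi_ball 0 1" for u
    using that by (simp_all add: koranyi_unit_ball_eq add.commute)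
  show "average (koranyi_ball 0 1) (\<lambda>u. u$1) = 0" "average (koranyi_ball 0 1) (\<lambda>u. u$1 * u$2) = 0"
    by (rule average_koranyi_ball_odd[OF lin(1) inv(1) pres(1)]; auto intro!: continuous_intros)+
  show "average (koranyi_ball 0 1) (\<lambda>u. u$2) = 0"
    by (rule average_koranyi_ball_odd[OF lin(2) inv(2) pres(2)]; auto intro!: continuous_intros)
  show "average (koranyi_ball 0 1) (\<lambda>u. u$3) = 0"
    by (rule average_koranyi_ball_odd[OF lin(3) inv(3) pres(3)]; auto intro!: continuous_intros)
  have eq: "average (koranyi_ball 0 1) (\<lambda>u. (u$2)\<^sup>2) = average (koranyi_ball 0 1) (\<lambda>u. (u$1)\<^sup>2)"
    using average_koranyi_ball_symmetry[OF lin(4) inv(4) pres(4), of "\<lambda>u. (u$1)\<^sup>2"]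
    by (simp add: continuous_intros)
  have "average (koranyi_ball 0 1) (\<lambda>u. (u$1)\<^sup>2) + average (koranyi_ball 0 1) (\<lambda>u. (u$2)\<^sup>2) = 4 / (3 * pi)"
    using average_hor_squared
    by (subst (asm) average_add[OF koranyi_unit_ball_props]) (auto intro!: continuous_intros)
  with eq show "average (koranyi_ball 0 1) (\<lambda>u. (u$1)\<^sup>2) = 2 / (3 * pi)"
    "average (koranyi_ball 0 1) (\<lambda>u. (u$2)\<^sup>2) = 2 / (3 * pi)"
    by auto
qed

text \<open>The height enters only linearly because the quadratic form of the expansion sees
  horizontal coordinates alone, and these do not depend on \<open>u$3\<close>.\<close>

lemma average_koranyi_ball_quadratic:
  "average (koranyi_ball 0 1) (\<lambda>u. c + (b1 * u$1 + (b2 * u$2 + (b3 * u$3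
      + (k11 * (u$1)\<^sup>2 + (k12 * (u$1 * u$2) + k22 * (u$2)\<^sup>2))))))
    = c + 2 / (3 * pi) * (k11 + k22)"
  by (simp add: average_add[OF koranyi_unit_ball_props] average_const[OF koranyi_unit_ball_props]
      average_cmult[OF koranyi_unit_ball_props] average_koranyi_ball_moments continuous_intros algebra_simps add_divide_distrib)

section \<open>Asymptotics of suprema and second order Taylor expansion\<close>

lemma eventually_at_right_0_less: "0 < b \<Longrightarrow> \<forall>\<^sub>F r in at_right 0. r < (b :: real)"
  by (auto simp: eventually_at_right_field)

text \<open>Where l stays below m - d, the loss r d in the linear term outweighs the bounded terms
  of order r^2 once r is small; elsewhere \<Phi> is close to \<Phi>0. This gives the upper bound.
  The lower bound comes from an almost maximiser of l.\<close>

lemma SUP_expansion: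
  fixes F :: "real \<Rightarrow> 'a \<Rightarrow> real"
  assumes le: "\<And>w. w \<in> B \<Longrightarrow> l w \<le> m" and bdd: "\<And>w. w \<in> B \<Longrightarrow> \<bar>\<Phi> w\<bar> \<le> M"
    and near: "\<And>e. e > 0 \<Longrightarrow> \<exists>d>0. \<forall>w\<in>B. l w > m - d \<longrightarrow> \<bar>\<Phi> w - \<Phi>0\<bar> \<le> e"
    and approx: "\<And>d. d > 0 \<Longrightarrow> \<exists>w\<in>B. l w > m - d"
    and F: "\<And>e. e > 0 \<Longrightarrow> \<forall>\<^sub>F r in at_right 0. \<forall>w\<in>B. \<bar>F r w - (k + r * l w + r\<^sup>2 * \<Phi> w)\<bar> \<le> e * r\<^sup>2"
    and e: "e > 0"
  shows "\<forall>\<^sub>F r in at_right 0. \<bar>(SUP w\<in>B. F r w) - (k + r * m + r\<^sup>2 * \<Phi>0)\<bar> \<le> e * r\<^sup>2"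
proof -
  have e4: "e / 4 > 0" using e by simp
  obtain d where d: "d > 0" "\<And>w. w \<in> B \<Longrightarrow> l w > m - d \<Longrightarrow> \<bar>\<Phi> w - \<Phi>0\<bar> \<le> e / 4"
    using near[OF e4] by blast
  have "\<exists>w. w \<in> B" using approx[of 1] by auto
  then have Mpos: "M \<ge> 0" and ne: "B \<noteq> {}" using bdd by force+
  \<comment> \<open>This threshold ensures r (M + |\<Phi>0|) <= d, the inequality by which the
    linear loss absorbs the second order terms.\<close>
  have "\<forall>\<^sub>F r in at_right 0. r < d / (M + \<bar>\<Phi>0\<bar> + 1)"
    using d(1) Mpos by (intro eventually_at_right_0_less divide_pos_pos) auto
  with eventually_at_right_less[of "0::real"] F[OF e4] show ?thesis
  proof eventually_elim
    case (elim r)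
    then have r: "r > 0" "r * (M + \<bar>\<Phi>0\<bar>) \<le> d"
      using Mpos by (auto simp: field_simps)
    have rr: "r * (r * (M + \<bar>\<Phi>0\<bar>)) \<le> r * d"
      using r by (intro mult_left_mono) auto
    have Fr: "\<bar>F r w - (k + r * l w + r\<^sup>2 * \<Phi> w)\<bar> \<le> e / 4 * r\<^sup>2" if "w \<in> B" for w
      using elim that by blast
    have up: "F r w \<le> k + r * m + r\<^sup>2 * \<Phi>0 + e / 2 * r\<^sup>2" if w: "w \<in> B" for w
    proof (cases "l w > m - d")
      case True
      have "r * l w \<le> r * m" using le[OF w] r by simp
      moreover have "r\<^sup>2 * \<Phi> w \<le> r\<^sup>2 * (\<Phi>0 + e / 4)"
        using d(2)[OF w True] by (intro mult_left_mono zero_le_power2) linarith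
      moreover have "F r w \<le> k + r * l w + r\<^sup>2 * \<Phi> w + e / 4 * r\<^sup>2"
        using Fr[OF w] by linarith
      ultimately show ?thesis by (simp add: algebra_simps)
    next
      case False
      then have "r * l w \<le> r * (m - d)" using r by simp
      moreover have "r\<^sup>2 * \<Phi> w \<le> r\<^sup>2 * M"
        using bdd[OF w] by (intro mult_left_mono) auto
      moreover have "r\<^sup>2 * (M + \<bar>\<Phi>0\<bar>) \<le> r * d" using rr by (simp add: power2_eq_square)
      moreover have "r\<^sup>2 * (- \<bar>\<Phi>0\<bar>) \<le> r\<^sup>2 * \<Phi>0" by (intro mult_left_mono) auto
      moreover have "F r w \<le> k + r * l w + r\<^sup>2 * \<Phi> w + e / 4 * r\<^sup>2"
        using Fr[OF w] by linarith
      moreover have "0 \<le> e / 4 * r\<^sup>2" using e by simp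
      ultimately show ?thesis by (simp add: algebra_simps)
    qed
    have "(SUP w\<in>B. F r w) \<le> k + r * m + r\<^sup>2 * \<Phi>0 + e / 2 * r\<^sup>2"
      using up ne by (rule cSUP_least[rotated])
    moreover have "k + r * m + r\<^sup>2 * \<Phi>0 - e * r\<^sup>2 \<le> (SUP w\<in>B. F r w)"
    proof -
      \<comment> \<open>The value m need not be attained on B, so w depends on r: a defect of at
        most (e/4) r in l costs only (e/4) r^2, while the bound d keeps \<Phi> near \<Phi>0.\<close>
      obtain w where w: "w \<in> B" "l w > m - min d (e / 4 * r)"
        using approx[of "min d (e / 4 * r)"] d(1) e r by auto
      have "r * (m - e / 4 * r) \<le> r * l w"
        using w r by (intro mult_left_mono) auto
      moreover have "r\<^sup>2 * (\<Phi>0 - e / 4) \<le> r\<^sup>2 * \<Phi> w"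
      proof (rule mult_left_mono)
        have "m - d < l w" using w(2) by linarith
        then show "\<Phi>0 - e / 4 \<le> \<Phi> w" using d(2)[OF w(1)] by linarith
      qed simp
      moreover have "k + r * l w + r\<^sup>2 * \<Phi> w - e / 4 * r\<^sup>2 \<le> F r w"
        using Fr[OF w(1)] by linarith
      moreover have "0 \<le> e / 4 * r\<^sup>2" using e by simp
      ultimately have "k + r * m + r\<^sup>2 * \<Phi>0 - e * r\<^sup>2 \<le> F r w"
        by (simp add: algebra_simps power2_eq_square)
      also have "\<dots> \<le> (SUP w\<in>B. F r w)"
        using w(1) up by (intro cSUP_upper) (auto intro!: bdd_aboveI2)
      finally show ?thesis .
    qed
    moreover have "e / 2 * r\<^sup>2 \<le> e * r\<^sup>2" using e by simp
    ultimately show ?case by (simp add: abs_le_iff algebra_simps)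
  qed
qed

section \<open>Taylor expansion along the dilations\<close>

lemma taylor_second_order_at:
  fixes v :: "'a::real_inner \<Rightarrow> real"
  assumes v: "\<And>w. (v has_derivative (\<lambda>h. g w \<bullet> h)) (at w)"
    and g: "(g has_derivative G) (at q)" and e: "e > 0"
  shows "\<exists>d>0. \<forall>k. norm k < d \<longrightarrow> \<bar>v (q + k) - (v q + g q \<bullet> k + (G k \<bullet> k) / 2)\<bar> \<le> e * (norm k)\<^sup>2"
proof -
  have lin: "linear G" using g by (rule has_derivative_linear)
  obtain d where d: "d > 0"
    "\<And>y. norm (y - q) < d \<Longrightarrow> norm (g y - g q - G (y - q)) \<le> e * norm (y - q)"
    using g e unfolding has_derivative_at_alt by blast
  have "\<bar>v (q + k) - (v q + g q \<bullet> k + (G k \<bullet> k) / 2)\<bar> \<le> e * (norm k)\<^sup>2" if k: "norm k < d" for k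
  proof -
    \<comment> \<open>With the quadratic model subtracted, the increment of this function over
      [0, 1] is the Taylor remainder, and its derivative is the first order remainder of the
      gradient paired with k. The mean value theorem then needs g to be differentiable only at
      q.\<close>
    let ?\<phi> = "\<lambda>t. v (q + t *\<^sub>R k) - t * (g q \<bullet> k) - t\<^sup>2 * ((G k \<bullet> k) / 2)"
    let ?\<phi>' = "\<lambda>t. (g (q + t *\<^sub>R k) - g q - G (t *\<^sub>R k)) \<bullet> k"
    have der: "(?\<phi> has_real_derivative ?\<phi>' t) (at t)" for t
    proof -
      have "((\<lambda>t. v (q + t *\<^sub>R k)) has_derivative (\<lambda>h. g (q + t *\<^sub>R k) \<bullet> (h *\<^sub>R k))) (at t)"
        by (rule has_derivative_compose[OF _ v]) (auto intro!: derivative_eq_intros)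
      then have 1: "((\<lambda>t. v (q + t *\<^sub>R k)) has_real_derivative g (q + t *\<^sub>R k) \<bullet> k) (at t)"
        by (simp add: has_field_derivative_def mult.commute[of _ "_ \<bullet> _"])
      show ?thesis
        by (rule derivative_eq_intros 1 refl)+
          (simp add: inner_diff_left linear_scale[OF lin])
    qed
    obtain t where t: "0 < t" "t < 1" "?\<phi> 1 - ?\<phi> 0 = (1 - 0) * ?\<phi>' t"
      using MVT2[of 0 1 ?\<phi> ?\<phi>'] der by auto
    have "norm (t *\<^sub>R k) \<le> norm k" using t by (simp add: mult_left_le_one_le)
    then have "norm (g (q + t *\<^sub>R k) - g q - G (t *\<^sub>R k)) \<le> e * norm (t *\<^sub>R k)"
      using d(2)[of "q + t *\<^sub>R k"] k by simp
    also have "\<dots> \<le> e * norm k"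
      using \<open>norm (t *\<^sub>R k) \<le> norm k\<close> e by (intro mult_left_mono) auto
    finally have "norm (g (q + t *\<^sub>R k) - g q - G (t *\<^sub>R k)) * norm k \<le> e * norm k * norm k"
      by (rule mult_right_mono) simp
    then have "\<bar>?\<phi>' t\<bar> \<le> e * (norm k)\<^sup>2"
      using Cauchy_Schwarz_ineq2[of "g (q + t *\<^sub>R k) - g q - G (t *\<^sub>R k)" k]
      by (simp add: power2_eq_square mult.assoc)
    moreover have "v (q + k) - (v q + g q \<bullet> k + (G k \<bullet> k) / 2) = ?\<phi>' t"
      using t(3) by simp
    ultimately show ?thesis by simp
  qed
  with d(1) show ?thesis by blast
qed

text \<open>The left invariant fields X and Y as Euclidean vectors at q: for differentiable v,
  \<open>heis_X v q\<close> and \<open>heis_Y v q\<close> are the derivatives in the directions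
  \<open>frame_X q\<close> and \<open>frame_Y q\<close>.\<close>

definition frame_X :: "real^3 \<Rightarrow> real^3"
  where "frame_X q = vector [1, 0, - q$2 / 2]"

definition frame_Y :: "real^3 \<Rightarrow> real^3"
  where "frame_Y q = vector [0, 1, q$1 / 2]"

text \<open>Sorts the Euclidean increment by order in r: the horizontal part is of order r, the
  vertical part of order r^2. Hence at second order the vertical part meets only the gradient, not
  the Hessian.\<close>

lemma heis_mult_dilation:
  "q \<odot> heis_dilation r W
    = q + (r *\<^sub>R (W$1 *\<^sub>R frame_X q + W$2 *\<^sub>R frame_Y q) + (r\<^sup>2 * W$3) *\<^sub>R axis 3 1)"
  by (simp add: vec_eq_iff forall_3 heis_mult_def heis_dilation_def frame_X_def frame_Y_def
      axis_def field_simps)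

lemma heis_taylor:
  fixes v :: "real^3 \<Rightarrow> real"
  assumes v: "\<And>w. (v has_derivative (\<lambda>h. g w \<bullet> h)) (at w)"
    and g: "(g has_derivative G) (at q)" and e: "e > 0"
  defines "e1 \<equiv> \<lambda>W :: real^3. W$1 *\<^sub>R frame_X q + W$2 *\<^sub>R frame_Y q"
  shows "\<forall>\<^sub>F r in at_right 0. \<forall>W. norm W \<le> C \<longrightarrow>
    \<bar>v (q \<odot> heis_dilation r W)
      - (v q + r * (g q \<bullet> e1 W) + r\<^sup>2 * (W$3 * g q $ 3 + (G (e1 W) \<bullet> e1 W) / 2))\<bar> \<le> e * r\<^sup>2"
proof (cases "C \<ge> 0")
  case C: True
  have lin: "linear G" and bl: "bounded_linear G"
    using g has_derivative_linear has_derivative_bounded_linear by blast+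
  define L where "L = onorm G"
  have L: "norm (G x) \<le> L * norm x" "L \<ge> 0" for x
    unfolding L_def using onorm[OF bl] onorm_pos_le[OF bl] by auto
  have GO: "\<bar>G x \<bullet> y\<bar> \<le> L * norm x * norm y" for x y
    using Cauchy_Schwarz_ineq2[of "G x" y] mult_right_mono[OF L(1)[of x] norm_ge_zero[of y]] by linarith
  define N where "N = C * (norm (frame_X q) + norm (frame_Y q))"
  have N: "N \<ge> 0" unfolding N_def using C by simp
  define K where "K = L * N * C + L * C * N + L * C * C"
  have K: "K \<ge> 0" unfolding K_def using C N L by simp
  \<comment> \<open>The increment will have norm at most r (N + C), so with this precision the
    Taylor remainder uses up half of e r^2. The other half is left for the Hessian terms of order
    r^3.\<close>
  define \<eta> where "\<eta> = e / (2 * ((N + C)\<^sup>2 + 1))"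
  have \<eta>: "\<eta> > 0" "\<eta> * (N + C)\<^sup>2 \<le> e / 2"
  proof -
    have p: "0 < (N + C)\<^sup>2 + 1" by (smt (verit) zero_le_power2)
    show "\<eta> > 0" unfolding \<eta>_def using e p by simp
    show "\<eta> * (N + C)\<^sup>2 \<le> e / 2" unfolding \<eta>_def using e p by (simp add: field_simps)
  qed
  obtain d where d: "d > 0"
    "\<And>k. norm k < d \<Longrightarrow> \<bar>v (q + k) - (v q + g q \<bullet> k + (G k \<bullet> k) / 2)\<bar> \<le> \<eta> * (norm k)\<^sup>2"
    using taylor_second_order_at[OF v g \<eta>(1)] by blast
  \<comment> \<open>The first threshold keeps the increment inside the Taylor radius d. The second
    gives r K <= e, where K bounds the coefficient of r^3.\<close>
  have p1: "d / (N + C + 1) > 0" "e / (K + 1) > 0" using d(1) N C K e by auto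
  show ?thesis
    using eventually_at_right_less[of "0::real"] eventually_at_right_0_less[OF zero_less_one] eventually_at_right_0_less[OF p1(1)] eventually_at_right_0_less[OF p1(2)]
  proof eventually_elim
    case (elim r)
    show ?case
    proof (intro allI impI)
      fix W :: "real^3" assume W: "norm W \<le> C"
      have comp: "\<bar>W$i\<bar> \<le> C" for i using component_le_norm_cart[of W i] W by linarith
      have "norm (e1 W) \<le> \<bar>W$1\<bar> * norm (frame_X q) + \<bar>W$2\<bar> * norm (frame_Y q)"
        unfolding e1_def by (rule order_trans[OF norm_triangle_ineq]) simp
      also have "\<dots> \<le> C * norm (frame_X q) + C * norm (frame_Y q)"
        by (intro add_mono mult_right_mono comp) auto
      finally have eN: "norm (e1 W) \<le> N" unfolding N_def by (simp add: algebra_simps)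
      let ?k = "r *\<^sub>R e1 W + (r\<^sup>2 * W$3) *\<^sub>R axis 3 1"
      have rr: "r\<^sup>2 \<le> r" using elim by (simp add: power2_eq_square mult_left_le_one_le)
      have "norm ?k \<le> r * norm (e1 W) + r\<^sup>2 * \<bar>W$3\<bar>"
        using elim norm_triangle_ineq[of "r *\<^sub>R e1 W" "(r\<^sup>2 * W$3) *\<^sub>R axis 3 1"]
        by (simp add: abs_mult)
      also have "\<dots> \<le> r * N + r * C"
        using elim eN comp[of 3] rr C by (intro add_mono mult_mono) auto
      finally have k: "norm ?k \<le> r * (N + C)" by (simp add: algebra_simps)
      also have "\<dots> \<le> r * (N + C + 1)" using elim by simp
      also have "\<dots> < d" using elim N C by (simp add: field_simps)
      finally have "\<bar>v (q + ?k) - (v q + g q \<bullet> ?k + (G ?k \<bullet> ?k) / 2)\<bar> \<le> \<eta> * (norm ?k)\<^sup>2"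
        by (rule d(2))
      also have "\<dots> \<le> \<eta> * (r * (N + C))\<^sup>2"
        using k \<eta>(1) by (intro mult_left_mono power_mono) auto
      also have "\<dots> = (\<eta> * (N + C)\<^sup>2) * r\<^sup>2" by (simp add: power_mult_distrib)
      also have "\<dots> \<le> e / 2 * r\<^sup>2" using \<eta>(2) by (rule mult_right_mono) simp
      finally have 1: "\<bar>v (q + ?k) - (v q + g q \<bullet> ?k + (G ?k \<bullet> ?k) / 2)\<bar> \<le> e / 2 * r\<^sup>2" .
      \<comment> \<open>All Hessian terms with at least one vertical factor, after extracting
        r^3.\<close>
      define D where "D = W$3 * (G (e1 W) \<bullet> axis 3 1) + W$3 * (G (axis 3 1) \<bullet> e1 W)
        + r * ((W$3 * W$3) * (G (axis 3 1) \<bullet> axis 3 1))"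
      have Gk: "G ?k \<bullet> ?k = r\<^sup>2 * (G (e1 W) \<bullet> e1 W) + r^3 * D"
        unfolding D_def
        by (simp add: linear_add[OF lin] linear_scale[OF lin] inner_add_left inner_add_right
            algebra_simps power2_eq_square power3_eq_cube)
      have gk: "g q \<bullet> ?k = r * (g q \<bullet> e1 W) + r\<^sup>2 * (W$3 * g q $ 3)"
        by (simp add: inner_add_right inner_axis)
      have "\<bar>W$3 * (G (e1 W) \<bullet> axis 3 1)\<bar> \<le> C * (L * N)"
        unfolding abs_mult using GO[of "e1 W" "axis 3 1"] mult_left_mono[OF eN L(2)] comp[of 3] C
        by (intro mult_mono) auto
      moreover have "\<bar>W$3 * (G (axis 3 1) \<bullet> e1 W)\<bar> \<le> C * (L * N)"
        unfolding abs_mult using GO[of "axis 3 1" "e1 W"] mult_left_mono[OF eN L(2)] comp[of 3] C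
        by (intro mult_mono) auto
      moreover have "\<bar>r * ((W$3 * W$3) * (G (axis 3 1) \<bullet> axis 3 1))\<bar> \<le> 1 * (C * C * L)"
        unfolding abs_mult using GO[of "axis 3 1" "axis 3 1"] comp[of 3] C elim L(2)
        by (intro mult_mono) auto
      ultimately have D: "\<bar>D\<bar> \<le> K"
        unfolding D_def K_def by (simp add: algebra_simps)
      have "r * K \<le> e" using elim K by (simp add: field_simps)
      then have "r * \<bar>D\<bar> \<le> e" using mult_left_mono[OF D, of r] elim by linarith
      then have "r\<^sup>2 * (r * \<bar>D\<bar>) \<le> r\<^sup>2 * e" by (rule mult_left_mono) simp
      then have 2: "\<bar>r^3 * D / 2\<bar> \<le> e / 2 * r\<^sup>2"
        using elim by (simp add: abs_mult power2_eq_square power3_eq_cube mult.commute mult.left_commute)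
      have kW: "q \<odot> heis_dilation r W = q + ?k"
        by (simp only: heis_mult_dilation e1_def)
      have eq: "v (q \<odot> heis_dilation r W)
          - (v q + r * (g q \<bullet> e1 W) + r\<^sup>2 * (W$3 * g q $ 3 + (G (e1 W) \<bullet> e1 W) / 2))
        = (v (q + ?k) - (v q + g q \<bullet> ?k + (G ?k \<bullet> ?k) / 2)) + r^3 * D / 2"
        unfolding kW Gk gk by (simp add: algebra_simps add_divide_distrib)
      show "\<bar>v (q \<odot> heis_dilation r W)
          - (v q + r * (g q \<bullet> e1 W) + r\<^sup>2 * (W$3 * g q $ 3 + (G (e1 W) \<bullet> e1 W) / 2))\<bar> \<le> e * r\<^sup>2"
        unfolding eq by (rule order_trans[OF abs_triangle_ineq]) (use 1 2 in linarith)
    qed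
  qed
next
  case False
  then have "\<not> norm W \<le> C" for W :: "real^3" using norm_ge_zero[of W] by linarith
  then show ?thesis by simp
qed

section \<open>The horizontal frame and the p-Laplacian\<close>

lemma partial_deriv_eq:
  assumes "(F has_derivative D) (at q)"
  shows "partial_deriv i F q = D (axis i 1)"
proof -
  have "((\<lambda>t. q + t *\<^sub>R axis i 1) has_derivative (\<lambda>h. h *\<^sub>R axis i 1)) (at 0)"
    by (auto intro!: derivative_eq_intros)
  from has_derivative_compose[OF this, of F D]
  have "((\<lambda>t. F (q + t *\<^sub>R axis i 1)) has_derivative (\<lambda>h. D (h *\<^sub>R axis i 1))) (at 0)"
    using assms by simp
  moreover have "(\<lambda>h. D (h *\<^sub>R axis i 1)) = (*) (D (axis i 1))"
    by (simp add: fun_eq_iff linear_scale[OF has_derivative_linear[OF assms]])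
  ultimately have "((\<lambda>t. F (q + t *\<^sub>R axis i 1)) has_real_derivative D (axis i 1)) (at 0)"
    by (simp add: has_field_derivative_def)
  then show ?thesis
    unfolding partial_deriv_def by (rule DERIV_imp_deriv)
qed

lemma frame_X_eq: "frame_X q = axis 1 1 - (q$2 / 2) *\<^sub>R axis 3 1"
  and frame_Y_eq: "frame_Y q = axis 2 1 + (q$1 / 2) *\<^sub>R axis 3 1"
  by (simp_all add: vec_eq_iff forall_3 frame_X_def frame_Y_def axis_def)

lemma heis_X_eq:
  assumes "(F has_derivative D) (at q)"
  shows "heis_X F q = D (frame_X q)" and "heis_Y F q = D (frame_Y q)"
  using has_derivative_linear[OF assms]
  by (simp_all add: heis_X_def heis_Y_def partial_deriv_eq[OF assms] frame_X_eq frame_Y_eq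
      linear_diff linear_add linear_scale)

lemma norm_vector_2: "norm (vector [a, b] :: real^2) = sqrt (a\<^sup>2 + b\<^sup>2)"
  by (simp add: norm_eq_sqrt_inner inner_vec_def sum_2 power2_eq_square)

lemma sqrt_powr: "0 < x \<Longrightarrow> sqrt x powr c = x powr (c / 2)"
  by (simp add: powr_half_sqrt[symmetric] powr_powr)

text \<open>With S the squared length of the horizontal gradient and c = (p - 2) / 2, both summands
  of the operator have the form X (S^c Xv), and the product and chain rules apply because S is
  positive at q. Dividing by S^c leaves the horizontal Laplacian and the second derivative form in
  the gradient direction. Both mixed entries are added in h12, the coefficient of x y.\<close>

lemma normalized_p_laplacian:
  fixes v :: "real^3 \<Rightarrow> real"
  assumes v: "\<And>w. (v has_derivative (\<lambda>h. g w \<bullet> h)) (at w)"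
    and g: "(g has_derivative G) (at q)" and nz: "heis_grad v q \<noteq> 0"
  defines "x \<equiv> g q \<bullet> frame_X q" and "y \<equiv> g q \<bullet> frame_Y q"
    and "h11 \<equiv> G (frame_X q) \<bullet> frame_X q" and "h22 \<equiv> G (frame_Y q) \<bullet> frame_Y q"
    and "h12 \<equiv> G (frame_X q) \<bullet> frame_Y q + G (frame_Y q) \<bullet> frame_X q"
  shows "heis_p_laplacian p v q / norm (heis_grad v q) powr (p - 2)
    = h11 + h22 + (p - 2) * ((x\<^sup>2 * h11 + x * y * h12 + y\<^sup>2 * h22) / (norm (heis_grad v q))\<^sup>2)"
proof -
  define a where "a = (\<lambda>w. g w \<bullet> frame_X w)"
  define b where "b = (\<lambda>w. g w \<bullet> frame_Y w)"
  define S where "S = (\<lambda>w. (a w)\<^sup>2 + (b w)\<^sup>2)"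
  define c where "c = (p - 2) / 2"
  have Xv: "heis_X v = a" and Yv: "heis_Y v = b"
    unfolding a_def b_def using heis_X_eq[OF v] by blast+
  have norm_grad: "norm (heis_grad v w) = sqrt (S w)" for w
    by (simp add: heis_grad_def Xv Yv norm_vector_2 S_def)
  have Sq: "S q > 0"
    using nz norm_grad[of q] by (metis norm_eq_zero real_sqrt_gt_0_iff zero_less_norm_iff)
  have powr_eq: "norm (heis_grad v w) powr (p - 2) = S w powr c" for w
    unfolding norm_grad c_def
    \<comment> \<open>The identity is needed at every w, since the function itself is
      differentiated. At zeros of S both sides vanish because \<open>0 powr c = 0\<close>.\<close>
    proof (cases "S w = 0")
    case False
    then have "S w > 0" by (simp add: S_def sum_power2_gt_zero_iff sum_power2_eq_zero_iff)
    then show "sqrt (S w) powr (p - 2) = S w powr ((p - 2) / 2)" by (rule sqrt_powr)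
  qed simp
  \<comment> \<open>Derivatives of Xv and Yv at q in direction k; the second summands come from the
    dependence of the frame on the base point.\<close>
  define da where "da = (\<lambda>k. G k \<bullet> frame_X q - g q \<bullet> ((k$2 / 2) *\<^sub>R axis 3 1))"
  define db where "db = (\<lambda>k. G k \<bullet> frame_Y q + g q \<bullet> ((k$1 / 2) *\<^sub>R axis 3 1))"
  have "linear (\<lambda>k::real^3. (k$2 / 2) *\<^sub>R (axis 3 1 :: real^3))"
    "linear (\<lambda>k::real^3. (k$1 / 2) *\<^sub>R (axis 3 1 :: real^3))"
    by (auto intro!: linearI simp: scaleR_left_distrib add_divide_distrib)
  note lin = this[THEN linear_imp_has_derivative]
  have "(frame_X has_derivative (\<lambda>k. 0 - (k$2 / 2) *\<^sub>R axis 3 1)) (at q)"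
    unfolding frame_X_eq[abs_def] by (intro has_derivative_diff has_derivative_const lin)
  from has_derivative_inner[OF g this] have a': "(a has_derivative da) (at q)"
    unfolding a_def da_def by (simp add: inner_diff_right algebra_simps)
  have "(frame_Y has_derivative (\<lambda>k. 0 + (k$1 / 2) *\<^sub>R axis 3 1)) (at q)"
    unfolding frame_Y_eq[abs_def] by (intro has_derivative_add has_derivative_const lin)
  from has_derivative_inner[OF g this] have b': "(b has_derivative db) (at q)"
    unfolding b_def db_def by (simp add: algebra_simps)
  define dS where "dS = (\<lambda>k. 2 * a q * da k + 2 * b q * db k)"
  have S': "(S has_derivative dS) (at q)"
    unfolding S_def by (rule derivative_eq_intros a' b' refl)+ (auto simp: fun_eq_iff dS_def)
  have P': "((\<lambda>w. S w powr c) has_derivative (\<lambda>k. dS k * (c * S q powr (c - 1)))) (at q)"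
    by (rule DERIV_compose_FDERIV[OF has_real_derivative_powr[OF Sq] S'])
  have "heis_p_laplacian p v q = heis_X (\<lambda>w. S w powr c * a w) q + heis_Y (\<lambda>w. S w powr c * b w) q"
    by (simp add: heis_p_laplacian_def powr_eq Xv Yv)
  also have "heis_X (\<lambda>w. S w powr c * a w) q
      = S q powr c * da (frame_X q) + dS (frame_X q) * (c * S q powr (c - 1)) * a q"
    using heis_X_eq(1)[OF has_derivative_mult[OF P' a']] by simp
  also have "heis_Y (\<lambda>w. S w powr c * b w) q
      = S q powr c * db (frame_Y q) + dS (frame_Y q) * (c * S q powr (c - 1)) * b q"
    using heis_X_eq(2)[OF has_derivative_mult[OF P' b']] by simp
  also have "S q powr (c - 1) = S q powr c / S q"
    using Sq by (simp add: powr_diff)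
  also have "S q powr c * da (frame_X q) + dS (frame_X q) * (c * (S q powr c / S q)) * a q
      + (S q powr c * db (frame_Y q) + dS (frame_Y q) * (c * (S q powr c / S q)) * b q)
    = S q powr c * (da (frame_X q) + db (frame_Y q) + c * ((dS (frame_X q) * a q + dS (frame_Y q) * b q) / S q))"
    using Sq by (simp add: field_simps)
  finally have L: "heis_p_laplacian p v q = S q powr c * (da (frame_X q) + db (frame_Y q)
      + c * ((dS (frame_X q) * a q + dS (frame_Y q) * b q) / S q))" .
  \<comment> \<open>The frame contributes nothing here: the second component of
    \<open>frame_X q\<close> and the first of \<open>frame_Y q\<close> are zero.\<close>
  have d: "da (frame_X q) = h11" "db (frame_Y q) = h22"
    by (simp_all add: da_def db_def h11_def h22_def frame_X_def frame_Y_def)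
  have h12: "h12 = db (frame_X q) + da (frame_Y q)"
    \<comment> \<open>the first-order terms of \<open>XYv\<close> and \<open>YXv\<close> cancel\<close>
    by (simp add: da_def db_def h12_def frame_X_def frame_Y_def)
  have ab: "a q = x" "b q = y" by (simp_all add: a_def b_def x_def y_def)
  have "dS (frame_X q) * a q + dS (frame_Y q) * b q = 2 * (x\<^sup>2 * h11 + x * y * h12 + y\<^sup>2 * h22)"
    unfolding dS_def ab d h12 by (simp add: algebra_simps power2_eq_square)
  then show ?thesis
    using Sq unfolding L d powr_eq unfolding norm_grad by (simp add: c_def field_simps)
qed

section \<open>Koranyi ellipsoids as affine images\<close>

text \<open>Dilations are group automorphisms and compose multiplicatively, so a translate centred
  at the moving point can be rewritten as a dilation by r based at the fixed point q.\<close>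

lemma heis_dilation_assoc:
  "(q \<odot> heis_dilation r w) \<odot> heis_dilation (s * r) x = q \<odot> heis_dilation r (w \<odot> heis_dilation s x)"
  by (simp add: vec_eq_iff forall_3 heis_mult_def heis_dilation_def field_simps power2_eq_square)

lemma koranyi_gauge_dilation: "0 \<le> r \<Longrightarrow> koranyi_gauge (heis_dilation r w) = r * koranyi_gauge w"
proof -
  assume r: "0 \<le> r"
  have "((r * w$1)\<^sup>2 + (r * w$2)\<^sup>2)\<^sup>2 + 16 * (r\<^sup>2 * w$3)\<^sup>2
      = r^4 * (((w$1)\<^sup>2 + (w$2)\<^sup>2)\<^sup>2 + 16 * (w$3)\<^sup>2)"
    by algebra
  then show ?thesis
    using r by (simp add: koranyi_gauge_def heis_dilation_def real_root_mult real_root_power_cancel)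
qed

text \<open>The distance is left invariant and the gauge is homogeneous under dilations.\<close>

lemma koranyi_ball_eq_image:
  assumes r: "r > 0"
  shows "koranyi_ball q r = (\<lambda>w. q \<odot> heis_dilation r w) ` koranyi_ball 0 1"
proof -
  have d0: "koranyi_dist 0 w = koranyi_gauge w" for w
    by (simp add: koranyi_dist_def koranyi_gauge_def heis_inv_def heis_mult_def)
  have cancel: "heis_inv q \<odot> (q \<odot> w) = w" for w
    by (simp add: vec_eq_iff forall_3 heis_mult_def heis_inv_def field_simps)
  have cancel': "q \<odot> (heis_inv q \<odot> w) = w" for w
    by (simp add: vec_eq_iff forall_3 heis_mult_def heis_inv_def field_simps)
  have dil: "heis_dilation r (heis_dilation (1 / r) w) = w" for w
    using r by (simp add: vec_eq_iff forall_3 heis_dilation_def power_divide)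
  show ?thesis
  proof (intro set_eqI iffI)
    fix q' assume q': "q' \<in> koranyi_ball q r"
    let ?w = "heis_dilation (1 / r) (heis_inv q \<odot> q')"
    have "koranyi_gauge ?w < 1"
      using q' r by (simp add: koranyi_gauge_dilation koranyi_ball_def koranyi_dist_def)
    moreover have "q' = q \<odot> heis_dilation r ?w"
      by (simp add: dil cancel')
    ultimately show "q' \<in> (\<lambda>w. q \<odot> heis_dilation r w) ` koranyi_ball 0 1"
      by (auto simp: koranyi_ball_def d0)
  next
    fix q' assume "q' \<in> (\<lambda>w. q \<odot> heis_dilation r w) ` koranyi_ball 0 1"
    then obtain w where "koranyi_gauge w < 1" "q' = q \<odot> heis_dilation r w"
      by (auto simp: koranyi_ball_def d0)
    then show "q' \<in> koranyi_ball q r"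
      using r by (simp add: koranyi_ball_def koranyi_dist_def cancel koranyi_gauge_dilation)
  qed
qed

lemma hor_heis_mult_dilation: "hor (q \<odot> heis_dilation r w - q) = r *\<^sub>R hor w"
  by (simp add: vec_eq_iff forall_2 hor_def heis_mult_def heis_dilation_def)

lemma heis_mult_dilation_affine:
  assumes L: "linear L"
  obtains A where "linear A" "\<And>u. q \<odot> heis_dilation r (L u) = q + A u"
    "r \<noteq> 0 \<Longrightarrow> inj L \<Longrightarrow> inj A"
proof
  let ?A = "\<lambda>u. r *\<^sub>R ((L u)$1 *\<^sub>R frame_X q + (L u)$2 *\<^sub>R frame_Y q) + (r\<^sup>2 * (L u)$3) *\<^sub>R axis 3 1"
  show lin: "linear ?A"
    by (rule linearI) (simp_all add: linear_add[OF L] linear_scale[OF L] algebra_simps)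
  show "q \<odot> heis_dilation r (L u) = q + ?A u" for u
    by (rule heis_mult_dilation)
  show "inj ?A" if r: "r \<noteq> 0" and inj: "inj L"
  proof (subst linear_injective_0[OF lin], intro allI impI)
    fix u assume "?A u = 0"
    then have "?A u $ i = 0" for i by simp
    from this[of 1] this[of 2] this[of 3] have "L u = 0"
      using r by (simp add: vec_eq_iff forall_3 frame_X_def frame_Y_def axis_def)
    then show "u = 0" using inj linear_injective_0[OF L] by blast
  qed
qed

text \<open>The stretching multiplies the direction n by \<alpha> and fixes its orthogonal
  complement, so it is injective and the affine image rule applies. The case n = 0 covers centres
  without horizontal displacement, where dividing by the norm 0 yields the zero vector and the set
  is a ball.\<close>

lemma ellipsoid_average_eq:
  assumes \<alpha>: "\<alpha> > 0" and n: "n = 0 \<or> norm n = 1" and r: "r > 0" and v: "continuous_on UNIV v"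
  shows "ellipsoid_average v r \<alpha> n q
      = average (koranyi_ball 0 1) (\<lambda>u. v (q \<odot> heis_dilation r (u + ((\<alpha> - 1) * (u \<bullet> n)) *\<^sub>R n)))"
    and "continuous_on UNIV (\<lambda>u. v (q \<odot> heis_dilation r (u + ((\<alpha> - 1) * (u \<bullet> n)) *\<^sub>R n)))"
proof -
  let ?L = "\<lambda>u. u + ((\<alpha> - 1) * (u \<bullet> n)) *\<^sub>R n"
  have L: "linear ?L" by (rule linearI) (simp_all add: inner_add_left algebra_simps)
  have "inj ?L"
  proof (subst linear_injective_0[OF L], intro allI impI)
    fix u assume u: "?L u = 0"
    show "u = 0"
    proof (cases "n = 0")
      case False
      then have "n \<bullet> n = 1" using n by (simp add: dot_square_norm)
      moreover have "?L u \<bullet> n = 0" using u by simp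
      ultimately have "\<alpha> * (u \<bullet> n) = 0" by (simp add: inner_add_left algebra_simps)
      then show ?thesis using u \<alpha> by simp
    qed (use u in simp)
  qed
  obtain A where A: "linear A" "\<And>u. q \<odot> heis_dilation r (?L u) = q + A u" "inj A"
    using heis_mult_dilation_affine[OF L, of q r] r \<open>inj ?L\<close> by (metis less_irrefl)
  show "ellipsoid_average v r \<alpha> n q = average (koranyi_ball 0 1) (\<lambda>u. v (q \<odot> heis_dilation r (?L u)))"
    using average_affine_image[OF A(1,3) bounded_koranyi_unit_ball lmeasurable_koranyi_unit_ball v, of q]
    by (simp add: ellipsoid_average_def koranyi_ellipsoid_def A(2) average_def)
  show "continuous_on UNIV (\<lambda>u. v (q \<odot> heis_dilation r (?L u)))"
    unfolding A(2) using A(1)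
    by (intro continuous_on_compose2[OF v] continuous_intros linear_continuous_on)
      (auto simp: linear_linear)
qed

section \<open>Expansion of the ellipsoid averages\<close>

text \<open>Here n is the direction of the horizontal part of w, t its length, b the excess of the
  aspect ratio over 1, and L = I + b n n^T the horizontal stretching. Averaging the form Q at w + s
  L u adds 2 s^2 / (3 pi) times the trace of the form composed with L. Since L^2 = I + (2 b + b^2) n
  n^T and w = t n, this produces the multiple (a - 1) (2 + (a - 1) t^2) of Q at w.\<close>

lemma average_second_order_model:
  fixes w1 w2 w3 n1 n2 a b t s r x y z vq h11 h12 h22 :: real
  assumes w: "w1 = t * n1" "w2 = t * n2" and b: "b = (a - 1) * t\<^sup>2"
    and n: "n1\<^sup>2 + n2\<^sup>2 = 1 \<or> t = 0"
  defines "W1 \<equiv> \<lambda>u :: real^3. w1 + s * (u$1 + b * (u$1 * n1 + u$2 * n2) * n1)"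
    and "W2 \<equiv> \<lambda>u :: real^3. w2 + s * (u$2 + b * (u$1 * n1 + u$2 * n2) * n2)"
    and "W3 \<equiv> \<lambda>u :: real^3. w3 + s\<^sup>2 * u$3 +
      s / 2 * (w1 * (u$2 + b * (u$1 * n1 + u$2 * n2) * n2) - w2 * (u$1 + b * (u$1 * n1 + u$2 * n2) * n1))"
    and "Q \<equiv> \<lambda>i j. i\<^sup>2 * h11 + i * j * h12 + j\<^sup>2 * h22"
  shows "average (koranyi_ball 0 1)
      (\<lambda>u. vq + r * (x * W1 u + y * W2 u) + r\<^sup>2 * (W3 u * z + Q (W1 u) (W2 u) / 2))
    = vq + r * (x * w1 + y * w2) + r\<^sup>2 * (w3 * z + Q w1 w2 / 2
        + s\<^sup>2 / (3 * pi) * (h11 + h22 + (a - 1) * (2 + (a - 1) * t\<^sup>2) * Q w1 w2))" (is "average _ ?P = ?rhs")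
    and "continuous_on UNIV
      (\<lambda>u. vq + r * (x * W1 u + y * W2 u) + r\<^sup>2 * (W3 u * z + Q (W1 u) (W2 u) / 2))"
proof -
  show "continuous_on UNIV ?P"
    unfolding W1_def W2_def W3_def Q_def by (intro continuous_intros) auto
  define l11 where "l11 = 1 + b * n1\<^sup>2"
  define l12 where "l12 = b * n1 * n2"
  define l22 where "l22 = 1 + b * n2\<^sup>2"
  have L: "u$1 + b * (u$1 * n1 + u$2 * n2) * n1 = l11 * u$1 + l12 * u$2"
    "u$2 + b * (u$1 * n1 + u$2 * n2) * n2 = l12 * u$1 + l22 * u$2" for u :: "real^3"
    by (simp_all add: l11_def l12_def l22_def algebra_simps power2_eq_square)
  define c0 where "c0 = vq + r * (x * w1 + y * w2) + r\<^sup>2 * (w3 * z + Q w1 w2 / 2)"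
  \<comment> \<open>Coefficients of the model as a polynomial in u. Those named b1, b2, b3 and k12
    multiply vanishing moments.\<close>
  define b1 where "b1 = r * s * (x * l11 + y * l12) + r\<^sup>2 * (z * (s / 2) * (w1 * l12 - w2 * l11)
    + (2 * w1 * s * l11 * h11 + (w1 * s * l12 + w2 * s * l11) * h12 + 2 * w2 * s * l12 * h22) / 2)"
  define b2 where "b2 = r * s * (x * l12 + y * l22) + r\<^sup>2 * (z * (s / 2) * (w1 * l22 - w2 * l12)
    + (2 * w1 * s * l12 * h11 + (w1 * s * l22 + w2 * s * l12) * h12 + 2 * w2 * s * l22 * h22) / 2)"
  define b3 where "b3 = r\<^sup>2 * z * s\<^sup>2"
  define k11 where "k11 = r\<^sup>2 * s\<^sup>2 / 2 * (l11\<^sup>2 * h11 + l11 * l12 * h12 + l12\<^sup>2 * h22)"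
  define k12 where "k12 = r\<^sup>2 * s\<^sup>2 / 2 * (2 * l11 * l12 * h11 + (l11 * l22 + l12\<^sup>2) * h12 + 2 * l12 * l22 * h22)"
  define k22 where "k22 = r\<^sup>2 * s\<^sup>2 / 2 * (l12\<^sup>2 * h11 + l12 * l22 * h12 + l22\<^sup>2 * h22)"
  have "?P u = c0 + (b1 * u$1 + (b2 * u$2 + (b3 * u$3
      + (k11 * (u$1)\<^sup>2 + (k12 * (u$1 * u$2) + k22 * (u$2)\<^sup>2)))))" for u
    unfolding W1_def W2_def W3_def Q_def L c0_def b1_def b2_def b3_def k11_def k12_def k22_def
    by (simp add: field_simps power2_eq_square)
  then have "average (koranyi_ball 0 1) ?P = c0 + 2 / (3 * pi) * (k11 + k22)"
    by (simp only: average_koranyi_ball_quadratic)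
  also have "k11 + k22 = r\<^sup>2 * s\<^sup>2 / 2 * (h11 + h22 + (a - 1) * (2 + (a - 1) * t\<^sup>2) * Q w1 w2)"
    using n
  proof
    assume n: "n1\<^sup>2 + n2\<^sup>2 = 1"
    \<comment> \<open>The entries of L^2.\<close>
    have l: "l11\<^sup>2 + l12\<^sup>2 = 1 + (2 * b + b\<^sup>2) * n1\<^sup>2" "l12\<^sup>2 + l22\<^sup>2 = 1 + (2 * b + b\<^sup>2) * n2\<^sup>2"
      "l12 * (l11 + l22) = (2 * b + b\<^sup>2) * (n1 * n2)"
      unfolding l11_def l12_def l22_def using n by algebra+
    have "k11 + k22 = r\<^sup>2 * s\<^sup>2 / 2 * (h11 * (l11\<^sup>2 + l12\<^sup>2) + h12 * (l12 * (l11 + l22)) + h22 * (l12\<^sup>2 + l22\<^sup>2))"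
      unfolding k11_def k22_def by (simp add: algebra_simps add_divide_distrib)
    also have "h11 * (l11\<^sup>2 + l12\<^sup>2) + h12 * (l12 * (l11 + l22)) + h22 * (l12\<^sup>2 + l22\<^sup>2)
        = h11 + h22 + (a - 1) * (2 + (a - 1) * t\<^sup>2) * Q w1 w2"
      unfolding l unfolding b w Q_def by algebra
    finally show ?thesis .
  next
    \<comment> \<open>Without horizontal displacement n need not be a unit vector, but then b = 0
      and L is the identity.\<close>
    assume "t = 0"
    then have "b = 0" "w1 = 0" "w2 = 0" using b w by auto
    then show ?thesis
      by (simp add: k11_def k22_def l11_def l12_def l22_def Q_def algebra_simps)
  qed
  also have "c0 + 2 / (3 * pi) * (r\<^sup>2 * s\<^sup>2 / 2 * (h11 + h22 + (a - 1) * (2 + (a - 1) * t\<^sup>2) * Q w1 w2)) = ?rhs"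
    unfolding c0_def by (simp add: algebra_simps)
  finally show "average (koranyi_ball 0 1) ?P = ?rhs" .
qed


lemma norm_of_hor: "norm (of_hor x) = norm x"
  by (simp add: norm_eq_sqrt_inner inner_vec_def sum_2 sum_3 of_hor_def)

lemma norm_hor_squared: "(norm (hor w))\<^sup>2 = (w$1)\<^sup>2 + (w$2)\<^sup>2"
  unfolding power2_norm_eq_inner by (simp add: inner_vec_def sum_2 hor_def power2_eq_square)

lemma norm_heis_mult_dilation_le:
  assumes w: "w \<in> koranyi_ball 0 1" and u: "norm u \<le> K" and s: "s > 0"
  shows "norm (w \<odot> heis_dilation s u) \<le> 3 + 4 * s * K + s\<^sup>2 * K"
proof -
  have K: "K \<ge> 0" using u norm_ge_zero order_trans by blast
  have comp: "\<bar>u$i\<bar> \<le> K" for i using component_le_norm_cart[of u i] u by linarith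
  have nw: "norm w \<le> 3"
    using norm_le_l1_cart[of w] koranyi_unit_ball_bounds[OF w] by (simp add: sum_3)
  have fr: "norm (frame_X w) \<le> 2" "norm (frame_Y w) \<le> 2"
    using norm_le_l1_cart[of "frame_X w"] norm_le_l1_cart[of "frame_Y w"] koranyi_unit_ball_bounds[OF w]
    by (simp_all add: sum_3 frame_X_def frame_Y_def)
  have "norm (u$1 *\<^sub>R frame_X w + u$2 *\<^sub>R frame_Y w) \<le> \<bar>u$1\<bar> * norm (frame_X w) + \<bar>u$2\<bar> * norm (frame_Y w)"
    by (rule order_trans[OF norm_triangle_ineq]) simp
  also have "\<dots> \<le> K * 2 + K * 2"
    using comp fr K by (intro add_mono mult_mono) auto
  finally have 1: "norm (s *\<^sub>R (u$1 *\<^sub>R frame_X w + u$2 *\<^sub>R frame_Y w)) \<le> s * (K * 2 + K * 2)"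
    using s by (simp add: mult_left_mono)
  have 2: "norm ((s\<^sup>2 * u$3) *\<^sub>R (axis 3 1 :: real^3)) \<le> s\<^sup>2 * K"
    using comp[of 3] by (simp add: abs_mult mult_left_mono)
  show ?thesis
    unfolding heis_mult_dilation
    using norm_add_rule_thm[OF nw norm_add_rule_thm[OF 1 2]] by (simp add: algebra_simps)
qed

text \<open>After the pull-back to the unit ball, v is replaced by its Taylor polynomial at the
  fixed point q, not at the moving centre, and that polynomial is averaged exactly. The remainder is
  uniform in w because all points involved have rescaled coordinates of norm at most C.\<close>

lemma ellipsoid_average_expansion:
  fixes v :: "real^3 \<Rightarrow> real"
  assumes v: "\<And>w. (v has_derivative (\<lambda>h. g w \<bullet> h)) (at w)"
    and g: "(g has_derivative G) (at q)" and s: "s > 0" and a: "a > 0" and e: "e > 0"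
  defines "x \<equiv> g q \<bullet> frame_X q" and "y \<equiv> g q \<bullet> frame_Y q"
    and "h11 \<equiv> G (frame_X q) \<bullet> frame_X q" and "h22 \<equiv> G (frame_Y q) \<bullet> frame_Y q"
    and "h12 \<equiv> G (frame_X q) \<bullet> frame_Y q + G (frame_Y q) \<bullet> frame_X q"
  defines "Q \<equiv> \<lambda>i j. i\<^sup>2 * h11 + i * j * h12 + j\<^sup>2 * h22"
  shows "\<forall>\<^sub>F r in at_right 0. \<forall>w\<in>koranyi_ball 0 1.
    \<bar>ellipsoid_average v (s * r)
        (1 + (a - 1) * ((norm (hor (q \<odot> heis_dilation r w - q)))\<^sup>2 / r\<^sup>2))
        (of_hor (hor (q \<odot> heis_dilation r w - q) /\<^sub>R norm (hor (q \<odot> heis_dilation r w - q))))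
        (q \<odot> heis_dilation r w)
      - (v q + r * (x * w$1 + y * w$2) + r\<^sup>2 * (w$3 * g q $ 3 + Q (w$1) (w$2) / 2
        + s\<^sup>2 / (3 * pi) * (h11 + h22 + (a - 1) * (2 + (a - 1) * ((w$1)\<^sup>2 + (w$2)\<^sup>2)) * Q (w$1) (w$2))))\<bar>
    \<le> e * r\<^sup>2"
proof -
  have lin: "linear G" using g by (rule has_derivative_linear)
  have contv: "continuous_on UNIV v"
    using v by (meson continuous_at_imp_continuous_on has_derivative_continuous)
  \<comment> \<open>K bounds the stretched vectors, C their translates by w after dilation by
    s.\<close>
  define K where "K = 3 + \<bar>a - 1\<bar> * 3"
  define C where "C = 3 + 4 * s * K + s\<^sup>2 * K"
  have Qeq: "G (i *\<^sub>R frame_X q + j *\<^sub>R frame_Y q) \<bullet> (i *\<^sub>R frame_X q + j *\<^sub>R frame_Y q) = Q i j" for i j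
    by (simp add: Q_def h11_def h22_def h12_def linear_add[OF lin] linear_scale[OF lin]
        inner_add_left inner_add_right algebra_simps power2_eq_square)
  have Q_app: "Q i j = i\<^sup>2 * h11 + i * j * h12 + j\<^sup>2 * h22" for i j
    by (simp add: Q_def)
  have xy: "g q \<bullet> (i *\<^sub>R frame_X q + j *\<^sub>R frame_Y q) = x * i + y * j" for i j
    by (simp add: x_def y_def inner_add_right)
  show ?thesis
    using eventually_at_right_less[of "0::real"] heis_taylor[OF v g e, of C]
  proof eventually_elim
    case (elim r)
    note r = elim(1)
    note taylor = elim(2)[unfolded Qeq xy, rule_format]
    show ?case
    proof
      fix w :: "real^3" assume w: "w \<in> koranyi_ball 0 1"
      define t where "t = norm (hor w)"
      define n where "n = of_hor (hor w /\<^sub>R t)"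
      have t2: "t\<^sup>2 = (w$1)\<^sup>2 + (w$2)\<^sup>2" by (simp add: t_def norm_hor_squared)
      then have t1: "0 \<le> t" "t\<^sup>2 < 1" using koranyi_unit_ball_bounds(1)[OF w] by (simp_all add: t_def)
      \<comment> \<open>The aspect ratio is a convex combination of 1 and a.\<close>
      have \<alpha>: "1 + (a - 1) * t\<^sup>2 > 0"
      proof -
        have "0 < (1 - t\<^sup>2) + a * t\<^sup>2" using t1 a by (simp add: add_pos_nonneg)
        then show ?thesis by (simp add: algebra_simps)
      qed
      have n: "n = 0 \<or> norm n = 1"
      proof (cases "t = 0")
        case True
        then show ?thesis by (simp add: n_def of_hor_def vec_eq_iff forall_3)
      next
        case False
        then show ?thesis by (simp add: n_def norm_of_hor) (simp add: t_def)
      qed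
      have n12: "n$1 = w$1 / t" "n$2 = w$2 / t" and n3: "n$3 = 0"
        by (simp_all add: n_def of_hor_def hor_def divide_inverse)
      have nn: "(n$1)\<^sup>2 + (n$2)\<^sup>2 = 1 \<or> t = 0"
      proof (cases "t = 0")
        case False
        have "(n$1)\<^sup>2 + (n$2)\<^sup>2 = t\<^sup>2 / t\<^sup>2"
          unfolding n12 t2 power_divide add_divide_distrib ..
        then show ?thesis using False by simp
      qed simp
      have "w$1 = 0 \<and> w$2 = 0" if "t = 0"
        using t2 that by (simp add: sum_power2_eq_zero_iff)
      then have wn: "w$1 = t * n$1" "w$2 = t * n$2"
        unfolding n12 by auto
      have hor_eq: "hor (q \<odot> heis_dilation r w - q) = r *\<^sub>R hor w"
        by (rule hor_heis_mult_dilation)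
      have arg1: "(norm (hor (q \<odot> heis_dilation r w - q)))\<^sup>2 / r\<^sup>2 = t\<^sup>2"
        using r by (simp add: hor_eq t_def power_mult_distrib)
      have arg2: "of_hor (hor (q \<odot> heis_dilation r w - q) /\<^sub>R norm (hor (q \<odot> heis_dilation r w - q))) = n"
      proof -
        have "inverse (r * t) * r = inverse t" using r by (simp add: field_simps)
        moreover have "norm (r *\<^sub>R hor w) = r * t"
          using r by (simp add: t_def)
        ultimately show ?thesis by (simp only: hor_eq n_def scaleR_scaleR)
      qed
      let ?L = "\<lambda>u. u + (((1 + (a - 1) * t\<^sup>2) - 1) * (u \<bullet> n)) *\<^sub>R n"
      let ?W = "\<lambda>u. w \<odot> heis_dilation s (?L u)"
      have sr: "s * r > 0" using s r by simp
      note avg = ellipsoid_average_eq[OF \<alpha> n sr contv, of "q \<odot> heis_dilation r w", unfolded heis_dilation_assoc]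
      have un: "u \<bullet> n = u$1 * n$1 + u$2 * n$2" for u by (simp add: inner_vec_def sum_3 n3)
      have W: "?W u $ 1 = w$1 + s * (u$1 + (a - 1) * t\<^sup>2 * (u$1 * n$1 + u$2 * n$2) * n$1)"
        "?W u $ 2 = w$2 + s * (u$2 + (a - 1) * t\<^sup>2 * (u$1 * n$1 + u$2 * n$2) * n$2)"
        "?W u $ 3 = w$3 + s\<^sup>2 * u$3 +
          s / 2 * (w$1 * (u$2 + (a - 1) * t\<^sup>2 * (u$1 * n$1 + u$2 * n$2) * n$2)
            - w$2 * (u$1 + (a - 1) * t\<^sup>2 * (u$1 * n$1 + u$2 * n$2) * n$1))" for u
        by (simp_all add: heis_mult_def heis_dilation_def un n3 field_simps)
      have bound: "norm (?W u) \<le> C" if u: "u \<in> koranyi_ball 0 1" for u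
        unfolding C_def
      proof (rule norm_heis_mult_dilation_le[OF w _ s])
        have u3: "norm u \<le> 3"
          using norm_le_l1_cart[of u] koranyi_unit_ball_bounds[OF u] by (simp add: sum_3)
        have nn1: "norm n \<le> 1" using n by auto
        have "\<bar>u \<bullet> n\<bar> \<le> norm u * norm n" by (rule Cauchy_Schwarz_ineq2)
        also have "\<dots> \<le> 3 * 1" using u3 nn1 by (intro mult_mono) auto
        finally have un3: "\<bar>u \<bullet> n\<bar> \<le> 3" by simp
        have "\<bar>a - 1\<bar> * t\<^sup>2 * \<bar>u \<bullet> n\<bar> * norm n \<le> \<bar>a - 1\<bar> * 1 * 3 * 1"
          using un3 nn1 t1 by (intro mult_mono) auto
        then show "norm (?L u) \<le> K"
          unfolding K_def using u3 by (intro norm_add_rule_thm) (auto simp: abs_mult)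
      qed
      note model = average_second_order_model[OF wn refl nn, where s = s and x = x and y = y and z = "g q $ 3"
          and vq = "v q" and r = r and ?w3.0 = "w$3" and ?h11.0 = h11 and ?h12.0 = h12 and ?h22.0 = h22 and a = a,
          folded W, folded Q_app]
      have "\<bar>average (koranyi_ball 0 1) (\<lambda>u. v (q \<odot> heis_dilation r (?W u)))
          - average (koranyi_ball 0 1) (\<lambda>u. v q + r * (x * ?W u $ 1 + y * ?W u $ 2)
              + r\<^sup>2 * (?W u $ 3 * g q $ 3 + Q (?W u $ 1) (?W u $ 2) / 2))\<bar> \<le> e * r\<^sup>2"
        by (rule average_diff_le[OF koranyi_unit_ball_props avg(2)])
          (use model(2) taylor bound in auto)
      then show "\<bar>ellipsoid_average v (s * r)
        (1 + (a - 1) * ((norm (hor (q \<odot> heis_dilation r w - q)))\<^sup>2 / r\<^sup>2))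
        (of_hor (hor (q \<odot> heis_dilation r w - q) /\<^sub>R norm (hor (q \<odot> heis_dilation r w - q))))
        (q \<odot> heis_dilation r w)
      - (v q + r * (x * w$1 + y * w$2) + r\<^sup>2 * (w$3 * g q $ 3 + Q (w$1) (w$2) / 2
        + s\<^sup>2 / (3 * pi) * (h11 + h22 + (a - 1) * (2 + (a - 1) * ((w$1)\<^sup>2 + (w$2)\<^sup>2)) * Q (w$1) (w$2))))\<bar>
        \<le> e * r\<^sup>2"
        unfolding arg1 arg2 avg(1) model(1) t2[symmetric] .
    qed
  qed
qed

section \<open>Infimum and supremum over small balls\<close>

text \<open>On the ball the linear form has supremum \<open>norm G\<close>, approached only near the
  horizontal unit vector along G, so \<open>SUP_expansion\<close> applies with the value of \<Phi>
  at that vector.\<close>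

lemma SUP_koranyi_ball_expansion:
  fixes G :: "real^2" and \<Phi> :: "real^3 \<Rightarrow> real"
  assumes G: "G \<noteq> 0" and \<Phi>: "continuous_on UNIV \<Phi>"
    and F: "\<And>e. e > 0 \<Longrightarrow> \<forall>\<^sub>F r in at_right 0. \<forall>w\<in>koranyi_ball 0 1.
      \<bar>F r w - (k + r * (G \<bullet> hor w) + r\<^sup>2 * \<Phi> w)\<bar> \<le> e * r\<^sup>2"
    and e: "e > 0"
  shows "\<forall>\<^sub>F r in at_right 0.
    \<bar>(SUP w\<in>koranyi_ball 0 1. F r w) - (k + r * norm G + r\<^sup>2 * \<Phi> (of_hor (G /\<^sub>R norm G)))\<bar> \<le> e * r\<^sup>2"
proof -
  define m where "m = norm G"
  define \<nu> where "\<nu> = G /\<^sub>R m"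
  have m: "m > 0" using G by (simp add: m_def)
  have \<nu>: "norm \<nu> = 1" "G = m *\<^sub>R \<nu>" using m by (simp_all add: \<nu>_def m_def)
  have hor1: "norm (hor w) < 1" if "w \<in> koranyi_ball 0 1" for w
    using koranyi_unit_ball_bounds(1)[OF that] norm_hor_squared[of w]
      power_less_imp_less_base[of "norm (hor w)" 2 1] by simp
  have "compact (\<Phi> ` closure (koranyi_ball 0 1))"
    using bounded_koranyi_unit_ball \<Phi>
    by (intro compact_continuous_image) (auto intro: continuous_on_subset)
  then obtain M where "\<forall>w\<in>closure (koranyi_ball 0 1). \<bar>\<Phi> w\<bar> \<le> M"
    by (auto simp: bounded_iff dest!: compact_imp_bounded)
  then have M: "\<bar>\<Phi> w\<bar> \<le> M" if "w \<in> koranyi_ball 0 1" for w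
    using closure_subset that by blast
  \<comment> \<open>The squared horizontal distance is at most 2 d / m. By the gauge, 16 times the
    squared height is below 1 - |hor w|^4 <= 4 (1 - |hor w|), so the height adds at most d / (4 m);
    together 9/4.\<close>
  have near: "(dist w (of_hor \<nu>))\<^sup>2 \<le> 9 / 4 * (d / m)"
    if w: "w \<in> koranyi_ball 0 1" and d: "G \<bullet> hor w > m - d" for w d
  proof -
    let ?t = "norm (hor w)"
    have 1: "\<nu> \<bullet> hor w > 1 - d / m"
      using d m by (simp add: \<nu>(2) field_simps)
    moreover have "\<nu> \<bullet> hor w \<le> ?t"
      using norm_cauchy_schwarz[of \<nu> "hor w"] \<nu>(1) by simp
    ultimately have t: "1 - d / m < ?t" by linarith
    have t1: "0 \<le> ?t" "?t < 1" using hor1[OF w] by auto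
    have "(?t\<^sup>2)\<^sup>2 + 16 * (w$3)\<^sup>2 < 1"
      using w by (simp add: koranyi_unit_ball_eq norm_hor_squared)
    moreover have "1 - (?t\<^sup>2)\<^sup>2 = (1 - ?t) * ((1 + ?t) * (1 + ?t\<^sup>2))" by algebra
    moreover have "(1 - ?t) * ((1 + ?t) * (1 + ?t\<^sup>2)) \<le> (1 - ?t) * (2 * 2)"
      using t1 by (intro mult_left_mono mult_mono) (auto simp: power_le_one)
    ultimately have w3: "(w$3)\<^sup>2 \<le> d / m / 4" using t by simp
    have "(dist w (of_hor \<nu>))\<^sup>2 = (norm (hor w - \<nu>))\<^sup>2 + (w$3)\<^sup>2"
      unfolding dist_norm power2_norm_eq_inner
      by (simp add: inner_vec_def sum_2 sum_3 hor_def of_hor_def power2_eq_square)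
    also have "(norm (hor w - \<nu>))\<^sup>2 = ?t\<^sup>2 + 1 - 2 * (\<nu> \<bullet> hor w)"
      using \<nu>(1) by (simp add: power2_norm_eq_inner inner_diff_left inner_diff_right inner_commute norm_eq_1)
    also have "\<dots> \<le> 2 * (d / m)"
      using 1 t1 power_le_one[of ?t 2] by simp
    finally show ?thesis using w3 by simp
  qed
  show ?thesis
    unfolding m_def[symmetric] \<nu>_def[symmetric]
  proof (rule SUP_expansion[OF _ M _ _ F e])
    fix w :: "real^3" assume w: "w \<in> koranyi_ball 0 1"
    show "G \<bullet> hor w \<le> m"
      using norm_cauchy_schwarz[of G "hor w"] mult_left_mono[of "norm (hor w)" 1 m] hor1[OF w] m
      unfolding m_def by linarith
  next
    fix e :: real assume "e > 0"
    then obtain \<delta> where \<delta>: "\<delta> > 0" "\<And>w. dist w (of_hor \<nu>) < \<delta> \<Longrightarrow> dist (\<Phi> w) (\<Phi> (of_hor \<nu>)) < e"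
      using \<Phi> unfolding continuous_on_iff by blast
    \<comment> \<open>With this defect the preceding estimate gives a squared distance of at most
      three quarters of \<delta> squared.\<close>
    have "\<bar>\<Phi> w - \<Phi> (of_hor \<nu>)\<bar> \<le> e"
      if "w \<in> koranyi_ball 0 1" "G \<bullet> hor w > m - m * \<delta>\<^sup>2 / 3" for w
    proof -
      have "(dist w (of_hor \<nu>))\<^sup>2 \<le> 9 / 4 * (m * \<delta>\<^sup>2 / 3 / m)"
        by (rule near[OF that])
      also have "\<dots> < \<delta>\<^sup>2" using m \<delta>(1) by simp
      finally have "dist w (of_hor \<nu>) < \<delta>"
        using \<delta>(1) by (simp add: power_less_imp_less_base)
      from \<delta>(2)[OF this] show ?thesis by (simp add: dist_real_def)
    qed
    then show "\<exists>d>0. \<forall>w\<in>koranyi_ball 0 1. m - d < G \<bullet> hor w \<longrightarrow> \<bar>\<Phi> w - \<Phi> (of_hor \<nu>)\<bar> \<le> e"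
      using m \<delta>(1) by (intro exI[of _ "m * \<delta>\<^sup>2 / 3"]) auto
  next
    fix d :: real assume d: "d > 0"
    \<comment> \<open>The ball is open and misses \<nu> itself, so a slightly shorter multiple of
      \<nu> serves; the lower limit 1/2 keeps the factor positive when d is large.\<close>
    define \<tau> where "\<tau> = max (1/2) (1 - d / (2 * m))"
    have \<tau>: "0 < \<tau>" "\<tau> < 1" "\<tau> > 1 - d / m"
      using d m by (auto simp: \<tau>_def less_max_iff_disj field_simps)
    let ?w = "\<tau> *\<^sub>R of_hor \<nu>"
    have hw: "hor ?w = \<tau> *\<^sub>R \<nu>"
      by (simp add: vec_eq_iff forall_2 hor_def of_hor_def)
    have "(norm (hor ?w))\<^sup>2 < 1"
      unfolding hw using \<tau> \<nu>(1) by (simp add: abs_square_less_1)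
    then have "((norm (hor ?w))\<^sup>2)\<^sup>2 < 1"
      by (simp only: abs_square_less_1 abs_power2)
    then have "?w \<in> koranyi_ball 0 1"
      unfolding koranyi_unit_ball_eq norm_hor_squared by (simp add: of_hor_def)
    moreover have "m - d < G \<bullet> hor ?w"
    proof -
      have "\<nu> \<bullet> \<nu> = 1" using \<nu>(1) by (simp add: norm_eq_1)
      then have "G \<bullet> hor ?w = m * \<tau>" unfolding hw \<nu>(2) by simp
      moreover have "m * (1 - d / m) < m * \<tau>" using \<tau>(3) m by (rule mult_strict_left_mono)
      moreover have "m * (1 - d / m) = m - d" using m by (simp add: right_diff_distrib)
      ultimately show ?thesis by linarith
    qed
    ultimately show "\<exists>w\<in>koranyi_ball 0 1. m - d < G \<bullet> hor w" by blast
  qed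
qed

theorem theorem5p2:
  fixes v :: "real^3 \<Rightarrow> real" and q :: "real^3" and p s a :: real
    and f :: "real \<Rightarrow> real^3 \<Rightarrow> real"
  assumes "C2 v"
    and "heis_grad v q \<noteq> 0"
    and "1 < p"
    and "s > 0" and "a > 0"
    and "3 * pi / (2 * s\<^sup>2) + a\<^sup>2 = p - 1"
    and "\<And>r q'. r > 0 \<Longrightarrow> q' \<in> koranyi_ball q r \<Longrightarrow>
      f r q' = ellipsoid_average v (s * r)
        (1 + (a - 1) * ((norm (hor (q' - q)))\<^sup>2 / r\<^sup>2))
        (of_hor (hor (q' - q) /\<^sub>R norm (hor (q' - q)))) q'"
  shows "(\<lambda>r. 1 / 2 * ((INF q'\<in>koranyi_ball q r. f r q') + (SUP q'\<in>koranyi_ball q r. f r q'))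
      - (v q + s\<^sup>2 * r\<^sup>2 / (3 * pi) *
          (heis_p_laplacian p v q / norm (heis_grad v q) powr (p - 2))))
    \<in> o[at_right 0](\<lambda>r. r\<^sup>2)"
proof -
  obtain g H where v: "\<And>w. (v has_derivative (\<lambda>h. g w \<bullet> h)) (at w)"
    and "\<And>w. (g has_derivative (\<lambda>h. H w *v h)) (at w)"
    using \<open>C2 v\<close> unfolding C2_def by blast
  then have g: "(g has_derivative ((*v) (H q))) (at q)" by simp
  define x where "x = g q \<bullet> frame_X q"
  define y where "y = g q \<bullet> frame_Y q"
  define h11 where "h11 = (H q *v frame_X q) \<bullet> frame_X q"
  define h22 where "h22 = (H q *v frame_Y q) \<bullet> frame_Y q"
  define h12 where "h12 = (H q *v frame_X q) \<bullet> frame_Y q + (H q *v frame_Y q) \<bullet> frame_X q"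
  define Q where "Q = (\<lambda>i j. i\<^sup>2 * h11 + i * j * h12 + j\<^sup>2 * h22)"
  define c where "c = s\<^sup>2 / (3 * pi)"
  define \<Phi> where "\<Phi> = (\<lambda>w :: real^3. w$3 * g q $ 3 + Q (w$1) (w$2) / 2
    + c * (h11 + h22 + (a - 1) * (2 + (a - 1) * ((w$1)\<^sup>2 + (w$2)\<^sup>2)) * Q (w$1) (w$2)))"
  define G where "G = heis_grad v q"
  have Gxy: "G = vector [x, y]"
    unfolding G_def heis_grad_def x_def y_def using heis_X_eq[OF v] by simp
  have G: "G \<noteq> 0" using assms(2) by (simp add: G_def)
  define F where "F = (\<lambda>r w. f r (q \<odot> heis_dilation r w))"
  have image: "f r ` koranyi_ball q r = F r ` koranyi_ball 0 1" if "r > 0" for r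
    unfolding koranyi_ball_eq_image[OF that] F_def by (rule image_image)
  note expansion = ellipsoid_average_expansion[OF v g \<open>s > 0\<close> \<open>a > 0\<close>]
  have F: "\<forall>\<^sub>F r in at_right 0. \<forall>w\<in>koranyi_ball 0 1.
      \<bar>F r w - (v q + r * (G \<bullet> hor w) + r\<^sup>2 * \<Phi> w)\<bar> \<le> e * r\<^sup>2" if e: "e > 0" for e
    using eventually_at_right_less[of "0::real"] expansion[OF e]
  proof eventually_elim
    case (elim r)
    have mem: "q \<odot> heis_dilation r w \<in> koranyi_ball q r" if "w \<in> koranyi_ball 0 1" for w
      unfolding koranyi_ball_eq_image[OF elim(1)] using that by (rule imageI)
    have hor: "G \<bullet> hor w = x * w$1 + y * w$2" for w
      by (simp add: Gxy inner_vec_def sum_2 hor_def)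
    show ?case
    proof
      fix w :: "real^3" assume w: "w \<in> koranyi_ball 0 1"
      show "\<bar>F r w - (v q + r * (G \<bullet> hor w) + r\<^sup>2 * \<Phi> w)\<bar> \<le> e * r\<^sup>2"
        unfolding F_def assms(7)[OF elim(1) mem[OF w]] hor \<Phi>_def c_def Q_def x_def y_def
          h11_def h22_def h12_def
        by (rule bspec[OF elim(2) w])
    qed
  qed
  have \<Phi>: "continuous_on UNIV \<Phi>"
    unfolding \<Phi>_def Q_def by (intro continuous_intros) auto
  define \<nu> where "\<nu> = G /\<^sub>R norm G"
  \<comment> \<open>The infimum is treated as the negative of the supremum of -F, whose expansion
    has the data -G and -\<Phi>.\<close>
  have F': "\<forall>\<^sub>F r in at_right 0. \<forall>w\<in>koranyi_ball 0 1.
      \<bar>- F r w - (- v q + r * (- G \<bullet> hor w) + r\<^sup>2 * - \<Phi> w)\<bar> \<le> e * r\<^sup>2" if "e > 0" for e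
  proof -
    have "- F r w - (- v q + r * (- G \<bullet> hor w) + r\<^sup>2 * - \<Phi> w)
        = - (F r w - (v q + r * (G \<bullet> hor w) + r\<^sup>2 * \<Phi> w))" for r w
      by simp
    then show ?thesis
      using F[OF that] by (simp only: abs_minus_cancel)
  qed
  have "norm \<nu> = 1" using G by (simp add: \<nu>_def)
  then have "\<nu> \<bullet> \<nu> = 1" by (simp add: norm_eq_1)
  then have \<nu>: "(\<nu>$1)\<^sup>2 + (\<nu>$2)\<^sup>2 = 1"
    by (simp add: inner_vec_def sum_2 power2_eq_square)
  have "\<nu>$1 = x / norm G" "\<nu>$2 = y / norm G"
    by (simp_all add: \<nu>_def Gxy divide_inverse)
  then have Q\<nu>: "Q (\<nu>$1) (\<nu>$2) = Q x y / (norm G)\<^sup>2"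
    by (simp add: Q_def power_divide add_divide_distrib power2_eq_square)
  \<comment> \<open>At horizontal points the height term vanishes and Q is even, so supremum and
    infimum see the same second order term.\<close>
  have neg: "\<Phi> (of_hor (- \<nu>)) = \<Phi> (of_hor \<nu>)"
    by (simp add: \<Phi>_def Q_def of_hor_def)
  \<comment> \<open>The relation between s, a and p, multiplied by c, trades the summand Q / 2 of
    the expansion for the right multiple of p - 2.\<close>
  have "c * (3 * pi / (2 * s\<^sup>2)) = 1 / 2"
    using \<open>s > 0\<close> by (simp add: c_def)
  moreover have "a\<^sup>2 = p - 1 - 3 * pi / (2 * s\<^sup>2)" using assms(6) by simp
  ultimately have "c * a\<^sup>2 = c * (p - 1) - 1 / 2"
    by (simp only: right_diff_distrib)
  then have ca: "1 / 2 + c * (a\<^sup>2 - 1) = c * (p - 2)"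
    by (simp add: algebra_simps)
  have "\<Phi> (of_hor \<nu>) = Q (\<nu>$1) (\<nu>$2) / 2
      + c * (h11 + h22 + (a - 1) * (2 + (a - 1) * ((\<nu>$1)\<^sup>2 + (\<nu>$2)\<^sup>2)) * Q (\<nu>$1) (\<nu>$2))"
    by (simp add: \<Phi>_def of_hor_def)
  \<comment> \<open>For a unit vector the factor (a - 1) (2 + (a - 1)) equals a^2 - 1.\<close>
  also have "\<dots> = c * (h11 + h22) + (1 / 2 + c * (a\<^sup>2 - 1)) * Q (\<nu>$1) (\<nu>$2)"
    unfolding \<nu> by (simp add: algebra_simps power2_eq_square)
  also have "\<dots> = c * (h11 + h22 + (p - 2) * (Q x y / (norm G)\<^sup>2))"
    unfolding ca Q\<nu> by (simp add: algebra_simps)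
  also have "\<dots> = c * (heis_p_laplacian p v q / norm G powr (p - 2))"
    using normalized_p_laplacian[OF v g assms(2)]
    by (simp add: Q_def G_def x_def y_def h11_def h22_def h12_def)
  finally have \<Phi>\<nu>: "\<Phi> (of_hor \<nu>) = c * (heis_p_laplacian p v q / norm G powr (p - 2))" .
  show ?thesis
  proof (rule landau_o.smallI)
    fix e :: real assume e: "e > 0"
    have sup: "\<forall>\<^sub>F r in at_right 0. \<bar>(SUP w\<in>koranyi_ball 0 1. F r w)
        - (v q + r * norm G + r\<^sup>2 * \<Phi> (of_hor \<nu>))\<bar> \<le> e * r\<^sup>2"
      unfolding \<nu>_def by (rule SUP_koranyi_ball_expansion[OF G \<Phi> F e])
    have sup': "\<forall>\<^sub>F r in at_right 0. \<bar>(SUP w\<in>koranyi_ball 0 1. - F r w)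
        - (- v q + r * norm (- G) + r\<^sup>2 * - \<Phi> (of_hor (- G /\<^sub>R norm (- G))))\<bar> \<le> e * r\<^sup>2"
      by (rule SUP_koranyi_ball_expansion[OF _ _ F' e]) (use G \<Phi> in \<open>auto intro!: continuous_intros\<close>)
    show "\<forall>\<^sub>F r in at_right 0. norm (1 / 2 * ((INF q'\<in>koranyi_ball q r. f r q') + (SUP q'\<in>koranyi_ball q r. f r q'))
      - (v q + s\<^sup>2 * r\<^sup>2 / (3 * pi) *
          (heis_p_laplacian p v q / norm (heis_grad v q) powr (p - 2)))) \<le> e * norm (r\<^sup>2)"
      using eventually_at_right_less[of "0::real"] sup sup'
    proof eventually_elim
      case (elim r)
      have inf: "(INF w\<in>koranyi_ball 0 1. F r w) = - (SUP w\<in>koranyi_ball 0 1. - F r w)"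
        unfolding Inf_real_def by (rule arg_cong[OF image_image])
      have "- G /\<^sub>R norm (- G) = - \<nu>"
        unfolding \<nu>_def by (simp only: norm_minus_cancel scaleR_minus_right)
      with elim(3) have "\<bar>(SUP w\<in>koranyi_ball 0 1. - F r w)
          - (- v q + r * norm G - r\<^sup>2 * \<Phi> (of_hor \<nu>))\<bar> \<le> e * r\<^sup>2"
        by (simp add: neg)
      \<comment> \<open>The linear terms r |G| and -r |G| cancel in the mean, and the two errors
        average to at most e r^2.\<close>
      with elim(2) have "\<bar>1 / 2 * ((INF w\<in>koranyi_ball 0 1. F r w) + (SUP w\<in>koranyi_ball 0 1. F r w))
          - (v q + r\<^sup>2 * \<Phi> (of_hor \<nu>))\<bar> \<le> e * r\<^sup>2"
        unfolding inf abs_le_iff by (auto simp: field_simps)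
      moreover have "s\<^sup>2 * r\<^sup>2 / (3 * pi) * L = r\<^sup>2 * (c * L)" for L
        by (simp add: c_def)
      ultimately show ?case
        by (simp only: image[OF elim(1)] \<Phi>\<nu> G_def real_norm_def abs_power2)
    qed
  qed
qed

end
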